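(* There exist constants $c_1,c_2>0$ such that for every $k$-wise independent random graph $\{\mathcal G^k(N,p)\}_N$ and every function $S:\mathbb N\to\mathbb N$, with probability tending to $1$ as $N\to\infty$, $\mathcal G^k(N,p)$ has no independent set of size $S(N)$, whenever either (1) $S(N)/(p(N)^{-1/2}N^{3/4})\to\infty$, $k\ge 4$, and $p(N)N^{1/2}\to\infty$; or (2) $S(N)\ge c_1\sqrt{N/p(N)}$, $k(N)\ge\log N$, and $p(N)\ge\frac{c_2\log N}{N}$.
   Context: A $k$-wise independent random graph $\{\mathcal G^k(N,p)\}_N$ is a sequence, indexed by $N$, of probability distributions on simple undirected graphs with vertex set $\{1,\dots,N\}$ such that every potential edge appears with probability $p(N)$ and the indicator random variables of the appearance of any $k(N)$ potential edges are mutually independent. $\log$ is the base-2 logarithm. *)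

theory Defs
  imports "HOL-Probability.Probability" "HOL-Library.Ramsey"
begin

text \<open>A simple undirected graph on the vertex set \<open>{1..N}\<close> is identified with its edge set, a
  subset of \<open>[{1..N}]\<^bsup>2\<^esup>\<close>. A sequence of distributions on such graphs is thus a sequence \<open>G\<close> of
  probability mass functions on edge sets.

  Independence is required of every set of at most \<open>k N\<close> potential edges. If \<open>k N\<close> does not exceed
  the number of potential edges, this is the same as requiring it of every set of exactly \<open>k N\<close>
  potential edges; otherwise it says that all potential edges are mutually independent (whereas
  the condition on sets of exactly \<open>k N\<close> edges would be vacuous).\<close>

definition k_wise_independent_random_graph ::
  "(nat \<Rightarrow> nat) \<Rightarrow> (nat \<Rightarrow> real) \<Rightarrow> (nat \<Rightarrow> nat set set pmf) \<Rightarrow> bool" where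
  "k_wise_independent_random_graph k p G \<longleftrightarrow>
    (\<forall>N. 0 \<le> p N \<and> p N \<le> 1 \<and>
         set_pmf (G N) \<subseteq> Pow ([{1..N}]\<^bsup>2\<^esup>) \<and>
         (\<forall>e \<in> [{1..N}]\<^bsup>2\<^esup>. measure_pmf.prob (G N) {E. e \<in> E} = p N) \<and>
         (\<forall>F. F \<subseteq> [{1..N}]\<^bsup>2\<^esup> \<and> card F \<le> k N \<longrightarrow>
              prob_space.indep_vars (measure_pmf (G N)) (\<lambda>_. borel)
                (\<lambda>e E. indicator E e :: real) F))"

definition has_independent_set :: "nat \<Rightarrow> nat set set \<Rightarrow> nat \<Rightarrow> bool" where
  "has_independent_set N E s \<longleftrightarrow> (\<exists>I \<subseteq> {1..N}. card I = s \<and> indep I E)"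

end

theory Submission
  imports Defs
begin

text \<open>Let \<open>E'\<close> be an independent copy of the random graph \<open>E\<close> and let \<open>Y\<close> be the difference of the
  adjacency matrices of \<open>E'\<close> and \<open>E\<close>. If \<open>E\<close> has an independent set of size \<open>s\<close>, with indicator
  vector \<open>x\<close>, then \<open>x\<^sup>T Y x\<close> has conditional mean \<open>p s (s - 1)\<close>, so by Jensen the conditional
  mean of \<open>tr Y\<^bsup>2r\<^esup>\<close> is at least \<open>(p (s - 1))\<^bsup>2r\<^esup>\<close>. Hence it suffices to bound the
  mean of \<open>tr Y\<^bsup>2r\<^esup>\<close>, where \<open>2r \<le> k\<close>.

  The entries of \<open>Y\<close> are symmetric random variables, so only closed walks that traverse every edge an
  even number of times contribute to the mean, with weight \<open>(2p(1-p))\<^bsup>e\<^esup>\<close> for \<open>e\<close> distinct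
  edges. Such a walk with \<open>t\<close> distinct vertices has \<open>t - 1 \<le> e \<le> r\<close>. On \<open>t \<le> r + 1\<close>
  given vertices there are at most \<open>(C r)\<^sup>r\<close> of them: the number of walks with visit counts \<open>n\<close> and
  edge counts \<open>g\<close> is at most the product of all \<open>n\<^sub>v!\<close> and all \<open>2\<^bsup>g(e)\<^esup> / g(e)!\<close>, which
  is summed over \<open>g\<close> and \<open>n\<close>. Together this gives a mean of at most \<open>2 N (C N p)\<^sup>r\<close> as soon as
  \<open>2 N p \<ge> r\<close>. The two cases of the theorem use \<open>r = 2\<close> and \<open>r\<close> of order \<open>log N\<close>.\<close>

subsection \<open>Counting walks with prescribed traversal counts\<close>

text \<open>A walk is a starting vertex together with the list of vertices visited after it. A step
  that stays put yields a singleton, so loop-freeness can be stated as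
  \<open>{v} \<notin> set (walk_edges i xs)\<close>.\<close>

fun walk_edges :: "'a \<Rightarrow> 'a list \<Rightarrow> 'a set list" where
  "walk_edges i [] = []"
| "walk_edges i (x # xs) = {i, x} # walk_edges x xs"

lemma length_walk_edges [simp]: "length (walk_edges i xs) = length xs"
  by (induction xs arbitrary: i) auto

lemma set_walk_edges_subset:
  "e \<in> set (walk_edges i xs) \<Longrightarrow> e \<subseteq> insert i (set xs)"
  by (induction xs arbitrary: i) fastforce+

lemma walk_edges_in_nsets:
  assumes "i \<in> V" "set xs \<subseteq> V" "\<And>v. {v} \<notin> set (walk_edges i xs)"
  shows "set (walk_edges i xs) \<subseteq> [V]\<^bsup>2\<^esup>"
  using assms
proof (induction xs arbitrary: i)
  case (Cons x xs)
  have "i \<noteq> x"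
    using Cons.prems(3)[of i] by auto
  moreover have "set (walk_edges x xs) \<subseteq> [V]\<^bsup>2\<^esup>"
    using Cons by auto
  ultimately show ?case
    using Cons.prems by auto
qed auto

text \<open>The traversed graph is connected: prepending a step either adds no vertex, or adds one
  that never recurs, and then the first edge is new as well.\<close>

lemma card_vertices_le_card_edges:
  "card (insert i (set xs)) \<le> card (set (walk_edges i xs)) + 1"
proof (induction xs arbitrary: i)
  case (Cons x xs)
  show ?case
  proof (cases "i \<in> insert x (set xs)")
    case True
    then have "insert i (set (x # xs)) = insert x (set xs)"
      by auto
    moreover have "card (set (walk_edges x xs)) \<le> card (set (walk_edges i (x # xs)))"
      by (intro card_mono) auto
    ultimately show ?thesis
      using Cons.IH[of x] by simp
  next
    case False
    then have "{i, x} \<notin> set (walk_edges x xs)"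
      using set_walk_edges_subset[of "{i, x}" x xs] by auto
    then show ?thesis
      using Cons.IH[of x] False by simp
  qed
qed auto

text \<open>Both sides count \<open>v\<close> in \<open>i # xs\<close>, with the first entry split
  off on the left and the last on the right.\<close>

lemma arrivals_departures:
  "count_list xs v + (if v = i then 1 else 0)
     = count_list (butlast (i # xs)) v + (if last (i # xs) = v then 1 else 0)"
proof -
  have "count_list (i # xs) v = count_list (butlast (i # xs) @ [last (i # xs)]) v"
    by (subst append_butlast_last_id) auto
  then show ?thesis
    unfolding count_list_append by (auto split: if_splits)
qed

text \<open>This is the degree of \<open>v\<close> in the traversed multigraph: a loop-free step is
  incident with exactly the vertex it leaves and the vertex it enters.\<close>

lemma sum_incident_edges:
  assumes "finite V" "i \<in> V" "set xs \<subseteq> V" "\<And>v. {v} \<notin> set (walk_edges i xs)"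
  shows "(\<Sum>w\<in>V - {v}. count_list (walk_edges i xs) {v, w})
           = count_list (butlast (i # xs)) v + count_list xs v"
  using assms
proof (induction xs arbitrary: i)
  case (Cons x xs)
  have ix: "i \<noteq> x"
    using Cons.prems(4)[of i] by auto
  have "(\<Sum>w\<in>V - {v}. (if {i, x} = {v, w} then 1 else 0 :: nat))
          = (\<Sum>w\<in>V - {v}. (if i = v \<and> w = x then 1 else 0) + (if x = v \<and> w = i then 1 else 0))"
    using ix by (intro sum.cong) (auto simp: doubleton_eq_iff)
  also have "\<dots> = (if i = v then 1 else 0) + (if x = v then 1 else 0)"
    using Cons.prems ix by (auto simp: sum.distrib)
  finally have *: "(\<Sum>w\<in>V - {v}. (if {i, x} = {v, w} then 1 else 0 :: nat)) = \<dots>" .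
  have "(\<Sum>w\<in>V - {v}. count_list (walk_edges i (x # xs)) {v, w})
      = (\<Sum>w\<in>V - {v}. (if {i, x} = {v, w} then 1 else 0) + count_list (walk_edges x xs) {v, w})"
    by (intro sum.cong) auto
  also have "\<dots> = (if i = v then 1 else 0) + (if x = v then 1 else 0)
                + (count_list (butlast (x # xs)) v + count_list xs v)"
    unfolding sum.distrib * using Cons by auto
  finally show ?case
    by auto
qed auto

text \<open>Departures are counted, not arrivals, so that deleting the first step changes
  \<open>n\<close> only at the starting vertex \<open>i\<close>.\<close>

definition walks_with_counts ::
  "'a set \<Rightarrow> nat \<Rightarrow> ('a \<Rightarrow> nat) \<Rightarrow> ('a set \<Rightarrow> nat) \<Rightarrow> 'a \<Rightarrow> 'a list set" where
  "walks_with_counts V L n g i = {xs. length xs = L \<and> set xs \<subseteq> V \<and>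
     count_list (butlast (i # xs)) = n \<and> count_list (walk_edges i xs) = g}"

lemma finite_walks_with_counts: "finite V \<Longrightarrow> finite (walks_with_counts V L n g i)"
  by (rule finite_subset[OF _ finite_lists_length_eq[of V L]]) (auto simp: walks_with_counts_def)

text \<open>Induction on the length. Removing a first step to \<open>w\<close> lowers
  \<open>n i\<close> and \<open>g {i, w}\<close> by one, and the right-hand side is built so that
  this multiplies it by \<open>g {i, w} / (2 * n i)\<close>.\<close>

lemma card_walks_with_counts:
  assumes "finite V" "i \<in> V" "\<And>v. g {v} = 0"
  shows "real (card (walks_with_counts V L n g i))
           \<le> (\<Prod>v\<in>V. fact (n v)) * (\<Prod>e\<in>[V]\<^bsup>2\<^esup>. 2 ^ g e / fact (g e))"
  using assms
proof (induction L arbitrary: i n g)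
  case 0
  show ?case
  proof (cases "walks_with_counts V 0 n g i = {}")
    case True
    then show ?thesis by (auto intro!: prod_nonneg mult_nonneg_nonneg)
  next
    case False
    then have "walks_with_counts V 0 n g i = {[]}" "n = (\<lambda>_. 0)" "g = (\<lambda>_. 0)"
      by (auto simp: walks_with_counts_def fun_eq_iff)
    then show ?thesis by simp
  qed
next
  case (Suc L)
  define R :: "('a \<Rightarrow> nat) \<Rightarrow> ('a set \<Rightarrow> nat) \<Rightarrow> real" where
    "R = (\<lambda>n g. (\<Prod>v\<in>V. fact (n v)) * (\<Prod>e\<in>[V]\<^bsup>2\<^esup>. 2 ^ g e / fact (g e)))"
  have R_nonneg: "R n g \<ge> 0" for n g
    unfolding R_def by (auto intro!: prod_nonneg mult_nonneg_nonneg)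
  show ?case
  proof (cases "walks_with_counts V (Suc L) n g i = {}")
    case True
    then show ?thesis by (auto intro!: prod_nonneg mult_nonneg_nonneg)
  next
    case False
    \<comment> \<open>One walk with these counts is enough to bound the total degree at
      \<open>i\<close>, since all of them share \<open>n\<close> and \<open>g\<close>.\<close>
    then obtain ys where ys: "length ys = Suc L" "set ys \<subseteq> V"
      "count_list (butlast (i # ys)) = n" "count_list (walk_edges i ys) = g"
      by (auto simp: walks_with_counts_def)
    have noloop: "{v} \<notin> set (walk_edges i ys)" for v
      using Suc.prems(3)[of v] ys(4) by (metis count_list_0_iff)
    have ni: "n i > 0"
      using ys(1,3) by (cases ys) auto
    have "(\<Sum>w\<in>V - {i}. g {i, w}) = n i + count_list ys i"
      using sum_incident_edges[OF Suc.prems(1,2) ys(2) noloop] ys by simp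
    also have "count_list ys i \<le> n i"
      using arrivals_departures[of ys i i] ys(3) by (auto split: if_splits)
    \<comment> \<open>A walk arrives at its starting point at most as often as it leaves it; this is why the
      weights \<open>g {i, w} / (2 * n i)\<close> of the possible first steps add up to at most 1.\<close>
    finally have deg: "(\<Sum>w\<in>V - {i}. g {i, w}) \<le> 2 * n i"
      by simp
    define n' where "n' = n(i := n i - 1)"
    define g' where "g' = (\<lambda>w. g({i, w} := g {i, w} - 1))"
    define W where "W = {w \<in> V - {i}. g {i, w} > 0}"
    have finW: "finite W" using Suc.prems by (auto simp: W_def)
    have "walks_with_counts V (Suc L) n g i \<subseteq> (\<Union>w\<in>W. (#) w ` walks_with_counts V L n' (g' w) w)"
    proof
      fix xs assume xs: "xs \<in> walks_with_counts V (Suc L) n g i"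
      then obtain w zs where [simp]: "xs = w # zs"
        by (cases xs) (auto simp: walks_with_counts_def)
      have n: "n = count_list (butlast (i # xs))" and g: "g = count_list (walk_edges i xs)"
        using xs by (auto simp: walks_with_counts_def)
      have "w \<noteq> i"
        using Suc.prems(3)[of i] g by auto
      then have "w \<in> W"
        using xs by (auto simp: W_def walks_with_counts_def)
      moreover have "zs \<in> walks_with_counts V L n' (g' w) w"
        using xs unfolding n'_def g'_def n g
        by (auto simp: walks_with_counts_def fun_eq_iff)
      ultimately show "xs \<in> (\<Union>w\<in>W. (#) w ` walks_with_counts V L n' (g' w) w)"
        by auto
    qed
    then have "card (walks_with_counts V (Suc L) n g i)
        \<le> card (\<Union>w\<in>W. (#) w ` walks_with_counts V L n' (g' w) w)"
      using Suc.prems finW by (intro card_mono finite_UN_I finite_imageI finite_walks_with_counts)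
    also have "\<dots> \<le> (\<Sum>w\<in>W. card ((#) w ` walks_with_counts V L n' (g' w) w))"
      by (rule card_UN_le[OF finW])
    also have "\<dots> = (\<Sum>w\<in>W. card (walks_with_counts V L n' (g' w) w))"
      by (intro sum.cong card_image) auto
    finally have "real (card (walks_with_counts V (Suc L) n g i))
        \<le> (\<Sum>w\<in>W. real (card (walks_with_counts V L n' (g' w) w)))"
      by (metis of_nat_le_iff of_nat_sum)
    also have "\<dots> \<le> (\<Sum>w\<in>W. R n' (g' w))"
    proof (intro sum_mono)
      fix w assume w: "w \<in> W"
      have "g' w {v} = 0" for v
        using Suc.prems(3) w by (auto simp: g'_def)
      then show "real (card (walks_with_counts V L n' (g' w) w)) \<le> R n' (g' w)"
        unfolding R_def using Suc.IH[of w "g' w" n'] Suc.prems w by (auto simp: W_def)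
    qed
    also have "\<dots> = (\<Sum>w\<in>W. R n g * (real (g {i, w}) / (2 * real (n i))))"
    proof (intro sum.cong refl)
      fix w assume w: "w \<in> W"
      have e: "{i, w} \<in> [V]\<^bsup>2\<^esup>" using w Suc.prems by (auto simp: W_def)
      have fin: "finite ([V]\<^bsup>2\<^esup>)" using Suc.prems by (simp add: finite_imp_finite_nsets)
      obtain a where a: "n i = Suc a" using ni by (cases "n i") auto
      obtain b where b: "g {i, w} = Suc b" using w by (cases "g {i, w}") (auto simp: W_def)
      have 1: "(\<Prod>v\<in>V. fact (n v)) = real (n i) * (\<Prod>v\<in>V. fact (n' v) :: real)"
        using Suc.prems a
        by (simp add: n'_def prod.remove[of V i])
      have 2: "(\<Prod>e\<in>[V]\<^bsup>2\<^esup>. 2 ^ g' w e / fact (g' w e) :: real) * 2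
          = (\<Prod>e\<in>[V]\<^bsup>2\<^esup>. 2 ^ g e / fact (g e)) * real (g {i, w})"
        using b by (simp add: g'_def prod.remove[OF fin e] field_simps del: of_nat_Suc)
      show "R n' (g' w) = R n g * (real (g {i, w}) / (2 * real (n i)))"
        unfolding R_def 1 using 2 ni by (simp add: field_simps)
    qed
    also have "\<dots> = R n g * (real (\<Sum>w\<in>W. g {i, w}) / (2 * real (n i)))"
      by (simp add: sum_distrib_left sum_divide_distrib)
    also have "(\<Sum>w\<in>W. g {i, w}) \<le> 2 * n i"
      using deg Suc.prems by (intro order_trans[OF sum_mono2 deg]) (auto simp: W_def)
    then have "R n g * (real (\<Sum>w\<in>W. g {i, w}) / (2 * real (n i))) \<le> R n g * 1"
      using ni by (intro mult_left_mono R_nonneg) (auto simp: divide_le_eq simp del: of_nat_sum)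
    finally show ?thesis by (simp add: R_def)
  qed
qed

section \<open>Double counting over edges and their endpoints\<close>

lemma bij_betw_edge_endpoints:
  "bij_betw (\<lambda>(v, w). ({v, w}, v)) (SIGMA v:V. V - {v}) (SIGMA e:[V]\<^bsup>2\<^esup>. e)"
  unfolding bij_betw_def
proof
  show "inj_on (\<lambda>(v, w). ({v, w}, v)) (SIGMA v:V. V - {v})"
    by (auto simp: inj_on_def doubleton_eq_iff)
  show "(\<lambda>(v, w). ({v, w}, v)) ` (SIGMA v:V. V - {v}) = (SIGMA e:[V]\<^bsup>2\<^esup>. e)"
  proof
    show "(SIGMA e:[V]\<^bsup>2\<^esup>. e) \<subseteq> (\<lambda>(v, w). ({v, w}, v)) ` (SIGMA v:V. V - {v})"
    proof clarify
      fix e v assume "e \<in> [V]\<^bsup>2\<^esup>" "v \<in> e"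
      then obtain w where "e = {v, w}" "v \<in> V" "w \<in> V" "v \<noteq> w"
        by (elim nsets2_E) (auto simp: insert_commute)
      then show "(e, v) \<in> (\<lambda>(v, w). ({v, w}, v)) ` (SIGMA v:V. V - {v})"
        by force
    qed
  qed auto
qed

lemma sum_edge_endpoints:
  fixes F :: "'a \<Rightarrow> 'a set \<Rightarrow> 'b::comm_monoid_add"
  assumes "finite V"
  shows "(\<Sum>v\<in>V. \<Sum>w\<in>V - {v}. F v {v, w}) = (\<Sum>e\<in>[V]\<^bsup>2\<^esup>. \<Sum>v\<in>e. F v e)"
proof -
  have "(\<Sum>v\<in>V. \<Sum>w\<in>V - {v}. F v {v, w}) = (\<Sum>(v, w)\<in>(SIGMA v:V. V - {v}). F v {v, w})"
    using assms by (intro sum.Sigma) auto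
  also have "\<dots> = (\<Sum>(e, v)\<in>(SIGMA e:[V]\<^bsup>2\<^esup>. e). F v e)"
    by (subst sum.reindex_bij_betw[OF bij_betw_edge_endpoints, symmetric]) (simp add: case_prod_unfold)
  also have "\<dots> = (\<Sum>e\<in>[V]\<^bsup>2\<^esup>. \<Sum>v\<in>e. F v e)"
    using assms by (intro sum.Sigma[symmetric]) (auto simp: finite_imp_finite_nsets nsets_def)
  finally show ?thesis .
qed

lemma prod_edge_endpoints:
  fixes F :: "'a \<Rightarrow> 'a set \<Rightarrow> 'b::comm_monoid_mult"
  assumes "finite V"
  shows "(\<Prod>v\<in>V. \<Prod>w\<in>V - {v}. F v {v, w}) = (\<Prod>e\<in>[V]\<^bsup>2\<^esup>. \<Prod>v\<in>e. F v e)"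
proof -
  have "(\<Prod>v\<in>V. \<Prod>w\<in>V - {v}. F v {v, w}) = (\<Prod>(v, w)\<in>(SIGMA v:V. V - {v}). F v {v, w})"
    using assms by (intro prod.Sigma) auto
  also have "\<dots> = (\<Prod>(e, v)\<in>(SIGMA e:[V]\<^bsup>2\<^esup>. e). F v e)"
    by (subst prod.reindex_bij_betw[OF bij_betw_edge_endpoints, symmetric]) (simp add: case_prod_unfold)
  also have "\<dots> = (\<Prod>e\<in>[V]\<^bsup>2\<^esup>. \<Prod>v\<in>e. F v e)"
    using assms by (intro prod.Sigma[symmetric]) (auto simp: finite_imp_finite_nsets nsets_def)
  finally show ?thesis .
qed

subsection \<open>Even closed walks\<close>

definition even_closed_walks :: "'a set \<Rightarrow> nat \<Rightarrow> ('a \<times> 'a list) set" where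
  "even_closed_walks V L = {(i, xs). length xs = L \<and> i \<in> V \<and> set xs \<subseteq> V \<and> last (i # xs) = i \<and>
     (\<forall>v. {v} \<notin> set (walk_edges i xs)) \<and> (\<forall>e. even (count_list (walk_edges i xs) e))}"

lemma finite_even_closed_walks: "finite V \<Longrightarrow> finite (even_closed_walks V L)"
  by (rule finite_subset[of _ "V \<times> {xs. set xs \<subseteq> V \<and> length xs = L}"])
     (auto simp: even_closed_walks_def finite_lists_length_eq)

section \<open>Elementary estimates for unions, factorials and exponential sums\<close>

lemma real_card_UN_le:
  "finite I \<Longrightarrow> real (card (\<Union>i\<in>I. A i)) \<le> (\<Sum>i\<in>I. real (card (A i)))"
  using card_UN_le[of I A] by (simp flip: of_nat_sum)

lemma pow2_mult_fact_le_fact_double: "(2::real) ^ m * fact m \<le> fact (2 * m)"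
proof (induction m)
  case (Suc m)
  have "(2::real) ^ Suc m * fact (Suc m) = (2 * (1 + real m)) * (2 ^ m * fact m)"
    by simp
  also have "\<dots> \<le> (2 * (1 + real m)) * fact (2 * m)"
    using Suc by (intro mult_left_mono) auto
  also have "\<dots> \<le> (2 * (1 + real m)) * ((1 + 2 * real m) * fact (2 * m))"
    by (intro mult_left_mono) (auto simp: mult_le_cancel_right1)
  also have "\<dots> = fact (2 * Suc m)"
    by (simp add: algebra_simps)
  finally show ?case .
qed simp

lemma sum_power_div_fact_le_exp:
  assumes "(x::real) \<ge> 0"
  shows "(\<Sum>k\<le>n. x ^ k / fact k) \<le> exp x"
proof -
  have s: "(\<lambda>k. x ^ k / fact k) sums exp x"
    using exp_converges[of x] by (simp add: field_simps)
  show ?thesis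
    using sum_le_suminf[OF sums_summable[OF s], of "{..n}"] sums_unique[OF s] assms by simp
qed

text \<open>Since \<open>n\<close> is the degree function of \<open>m\<close>, the upper bound \<open>\<Prod>v. n v ^ n v\<close> for the
  product of the factorials distributes over the edges, and a sum of multinomial type remains.\<close>

lemma sum_edge_multiplicities_bound:
  fixes n :: "'a \<Rightarrow> nat" and r :: nat
  assumes "finite V" "r > 0" "(\<Sum>v\<in>V. n v) = 2 * r"
  defines "M \<equiv> {m \<in> [V]\<^bsup>2\<^esup> \<rightarrow>\<^sub>E {..r}. \<forall>v\<in>V. (\<Sum>w\<in>V - {v}. m {v, w}) = n v}"
  shows "(\<Sum>m\<in>M. (\<Prod>v\<in>V. fact (n v)) * (\<Prod>e\<in>[V]\<^bsup>2\<^esup>. 2 ^ (2 * m e) / fact (2 * m e)))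
           \<le> (4 * exp 1 * real r) ^ r"
proof -
  have finE: "finite ([V]\<^bsup>2\<^esup>)"
    using assms by (simp add: finite_imp_finite_nsets)
  have finP: "finite ([V]\<^bsup>2\<^esup> \<rightarrow>\<^sub>E {..r})"
    using finE by (intro finite_PiE) auto
  define b :: "'a set \<Rightarrow> real" where "b e = (\<Prod>v\<in>e. real (n v))" for e
  have b_nonneg: "b e \<ge> 0" for e
    by (auto simp: b_def intro!: prod_nonneg)
  \<comment> \<open>The weight \<open>t ^ m e\<close> can be inserted because the multiplicities sum
    to \<open>r\<close>. The resulting bound is \<open>(1 / t) ^ r * exp (t * (2 * r) ^ 2)\<close>,
    and this \<open>t\<close> minimizes it.\<close>
  define t :: real where "t = 1 / (4 * real r)"
  have t: "t > 0" using assms by (simp add: t_def)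
  have termwise: "(\<Prod>v\<in>V. fact (n v)) * (\<Prod>e\<in>[V]\<^bsup>2\<^esup>. 2 ^ (2 * m e) / fact (2 * m e))
       \<le> (1 / t) ^ r * (\<Prod>e\<in>[V]\<^bsup>2\<^esup>. (2 * t * b e) ^ m e / fact (m e))" if m: "m \<in> M" for m
  proof -
    have deg: "(\<Sum>w\<in>V - {v}. m {v, w}) = n v" if "v \<in> V" for v
      using m that by (auto simp: M_def)
    have "2 * r = (\<Sum>v\<in>V. \<Sum>w\<in>V - {v}. m {v, w})"
      using assms deg by simp
    also have "\<dots> = 2 * (\<Sum>e\<in>[V]\<^bsup>2\<^esup>. m e)"
      using sum_edge_endpoints[OF assms(1), of "\<lambda>v e. m e"]
      by (simp add: sum_distrib_left nsets_def)
    finally have sum_m: "(\<Sum>e\<in>[V]\<^bsup>2\<^esup>. m e) = r" by simp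
    have "(\<Prod>v\<in>V. fact (n v)) \<le> (\<Prod>v\<in>V. real (n v) ^ n v)"
      by (intro prod_mono) (auto intro: order_trans[OF fact_le_power])
    also have "\<dots> = (\<Prod>v\<in>V. \<Prod>w\<in>V - {v}. real (n v) ^ m {v, w})"
      using deg by (intro prod.cong) (auto simp: power_sum[symmetric])
    also have "\<dots> = (\<Prod>e\<in>[V]\<^bsup>2\<^esup>. b e ^ m e)"
      by (subst prod_edge_endpoints[OF assms(1), of "\<lambda>v e. real (n v) ^ m e"])
         (simp add: b_def prod_power_distrib)
    finally have 1: "(\<Prod>v\<in>V. fact (n v)) \<le> (\<Prod>e\<in>[V]\<^bsup>2\<^esup>. b e ^ m e)" .
    have 2: "(\<Prod>e\<in>[V]\<^bsup>2\<^esup>. 2 ^ (2 * m e) / fact (2 * m e)) \<le> (\<Prod>e\<in>[V]\<^bsup>2\<^esup>. (2::real) ^ m e / fact (m e))"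
    proof (intro prod_mono conjI)
      fix e :: "'a set"
      show "(2::real) ^ (2 * m e) / fact (2 * m e) \<le> 2 ^ m e / fact (m e)"
        using mult_left_mono[OF pow2_mult_fact_le_fact_double[of "m e"], of "2 ^ m e"]
        by (simp add: field_simps power_mult power2_eq_square flip: power_mult_distrib)
    qed auto
    have "(\<Prod>v\<in>V. fact (n v)) * (\<Prod>e\<in>[V]\<^bsup>2\<^esup>. 2 ^ (2 * m e) / fact (2 * m e))
        \<le> (\<Prod>e\<in>[V]\<^bsup>2\<^esup>. b e ^ m e) * (\<Prod>e\<in>[V]\<^bsup>2\<^esup>. (2::real) ^ m e / fact (m e))"
      by (intro mult_mono 1 2) (auto intro!: prod_nonneg b_nonneg zero_le_power)
    also have "\<dots> = (\<Prod>e\<in>[V]\<^bsup>2\<^esup>. (1 / t) ^ m e * ((2 * t * b e) ^ m e / fact (m e)))"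
      unfolding prod.distrib[symmetric]
      using t by (intro prod.cong) (auto simp: power_mult_distrib power_one_over)
    also have "\<dots> = (1 / t) ^ r * (\<Prod>e\<in>[V]\<^bsup>2\<^esup>. (2 * t * b e) ^ m e / fact (m e))"
      unfolding prod.distrib by (simp add: sum_m flip: power_sum)
    finally show ?thesis .
  qed
  have "(\<Sum>m\<in>M. (\<Prod>v\<in>V. fact (n v)) * (\<Prod>e\<in>[V]\<^bsup>2\<^esup>. 2 ^ (2 * m e) / fact (2 * m e)))
      \<le> (\<Sum>m\<in>M. (1 / t) ^ r * (\<Prod>e\<in>[V]\<^bsup>2\<^esup>. (2 * t * b e) ^ m e / fact (m e)))"
    by (intro sum_mono termwise)
  \<comment> \<open>Dropping the degree constraint gives a sum over a full product space, which
    factors over the edges into truncated exponential series.\<close>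
  also have "\<dots> \<le> (\<Sum>m\<in>[V]\<^bsup>2\<^esup> \<rightarrow>\<^sub>E {..r}. (1 / t) ^ r * (\<Prod>e\<in>[V]\<^bsup>2\<^esup>. (2 * t * b e) ^ m e / fact (m e)))"
    using t b_nonneg finP
    by (intro sum_mono2) (auto simp: M_def intro!: mult_nonneg_nonneg prod_nonneg divide_nonneg_nonneg)
  also have "\<dots> = (1 / t) ^ r * (\<Prod>e\<in>[V]\<^bsup>2\<^esup>. \<Sum>k\<le>r. (2 * t * b e) ^ k / fact k)"
    using finE by (simp add: prod_sum_PiE sum_distrib_left)
  also have "\<dots> \<le> (1 / t) ^ r * (\<Prod>e\<in>[V]\<^bsup>2\<^esup>. exp (2 * t * b e))"
    using t b_nonneg
    by (intro mult_left_mono prod_mono conjI sum_power_div_fact_le_exp)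
       (auto intro!: sum_nonneg divide_nonneg_nonneg)
  also have "\<dots> = (1 / t) ^ r * exp (t * (\<Sum>e\<in>[V]\<^bsup>2\<^esup>. 2 * b e))"
    using finE by (simp add: exp_sum sum_distrib_left mult_ac)
  also have "(\<Sum>e\<in>[V]\<^bsup>2\<^esup>. 2 * b e) = (\<Sum>v\<in>V. \<Sum>w\<in>V - {v}. b {v, w})"
    by (subst sum_edge_endpoints[OF assms(1), of "\<lambda>v e. b e"]) (simp add: nsets_def)
  also have "\<dots> \<le> (\<Sum>v\<in>V. \<Sum>w\<in>V. real (n v) * real (n w))"
    using assms by (intro sum_mono order_trans[OF sum_mono sum_mono2]) (auto simp: b_def)
  also have "\<dots> = (2 * real r)\<^sup>2"
    using arg_cong[OF assms(3), of real] by (simp add: power2_eq_square flip: sum_product)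
  finally have "(\<Sum>m\<in>M. (\<Prod>v\<in>V. fact (n v)) * (\<Prod>e\<in>[V]\<^bsup>2\<^esup>. 2 ^ (2 * m e) / fact (2 * m e)))
      \<le> (1 / t) ^ r * exp (t * (2 * real r)\<^sup>2)"
    using t by simp
  also have "t * (2 * real r)\<^sup>2 = real r"
    using assms(2) by (simp add: t_def power2_eq_square)
  also have "(1 / t) ^ r * exp (real r) = (4 * exp 1 * real r) ^ r"
    by (simp add: t_def power_mult_distrib flip: exp_of_nat_mult)
  finally show ?thesis .
qed

text \<open>In a closed walk arrivals and departures agree, so each vertex has degree
  \<open>2 * n v\<close>. Halving the even edge counts gives multiplicities with degree function
  \<open>n\<close>, and the walk counts are summed over these.\<close>

lemma card_even_closed_walks_profile:
  assumes "finite V" "i \<in> V" "r > 0" "(\<Sum>v\<in>V. n v) = 2 * r"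
  shows "real (card {xs. (i, xs) \<in> even_closed_walks V (2 * r) \<and> count_list xs = n})
           \<le> (4 * exp 1 * real r) ^ r"
proof -
  have finE: "finite ([V]\<^bsup>2\<^esup>)"
    using assms by (simp add: finite_imp_finite_nsets)
  define M where "M = {m \<in> [V]\<^bsup>2\<^esup> \<rightarrow>\<^sub>E {..r}. \<forall>v\<in>V. (\<Sum>w\<in>V - {v}. m {v, w}) = n v}"
  \<comment> \<open>Members of \<open>M\<close> are \<open>undefined\<close> off the edges; the
    value 0 there lets \<open>g m\<close> equal the count function of a walk and excludes
    loops.\<close>
  define g where "g = (\<lambda>m e. if e \<in> [V]\<^bsup>2\<^esup> then 2 * m e else 0 :: nat)"
  have finM: "finite M"
    unfolding M_def using finE by (intro finite_subset[OF _ finite_PiE[of "[V]\<^bsup>2\<^esup>" "\<lambda>_. {..r}"]]) auto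
  have "{xs. (i, xs) \<in> even_closed_walks V (2 * r) \<and> count_list xs = n}
      \<subseteq> (\<Union>m\<in>M. walks_with_counts V (2 * r) n (g m) i)"
  proof clarify
    fix xs assume xs: "(i, xs) \<in> even_closed_walks V (2 * r)" and n: "n = count_list xs"
    have len: "length xs = 2 * r" and sub: "set xs \<subseteq> V" and cl: "last (i # xs) = i"
      and noloop: "\<And>v. {v} \<notin> set (walk_edges i xs)"
      and ev: "\<And>e. even (count_list (walk_edges i xs) e)"
      using xs by (auto simp: even_closed_walks_def)
    have dep: "count_list (butlast (i # xs)) = count_list xs"
    proof
      show "count_list (butlast (i # xs)) v = count_list xs v" for v
        using arrivals_departures[of xs v i] cl by (auto split: if_splits)
    qed
    define m where "m = (\<lambda>e\<in>[V]\<^bsup>2\<^esup>. count_list (walk_edges i xs) e div 2)"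
    have "count_list (walk_edges i xs) e \<le> 2 * r" for e
      using count_le_length[of "walk_edges i xs" e] len by simp
    then have 1: "m \<in> [V]\<^bsup>2\<^esup> \<rightarrow>\<^sub>E {..r}"
      by (auto simp: m_def intro: div_le_mono[where k = 2, of _ "2 * r", simplified])
    have 2: "g m = count_list (walk_edges i xs)"
      using ev walk_edges_in_nsets[OF assms(2) sub noloop]
      by (auto simp: g_def m_def fun_eq_iff count_list_0_iff)
    have "(\<Sum>w\<in>V - {v}. m {v, w}) = count_list xs v" if "v \<in> V" for v
    proof -
      have "2 * (\<Sum>w\<in>V - {v}. m {v, w}) = (\<Sum>w\<in>V - {v}. g m {v, w})"
        unfolding sum_distrib_left using that by (intro sum.cong) (auto simp: g_def)
      also have "\<dots> = 2 * count_list xs v"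
        unfolding 2 using sum_incident_edges[OF assms(1,2) sub noloop, of v] dep by simp
      finally show ?thesis by simp
    qed
    then have "m \<in> M" using 1 n by (simp add: M_def)
    moreover have "xs \<in> walks_with_counts V (2 * r) (count_list xs) (g m) i"
      unfolding 2 using dep len sub by (simp add: walks_with_counts_def)
    ultimately show "xs \<in> (\<Union>m\<in>M. walks_with_counts V (2 * r) (count_list xs) (g m) i)" by blast
  qed
  then have "card {xs. (i, xs) \<in> even_closed_walks V (2 * r) \<and> count_list xs = n}
      \<le> card (\<Union>m\<in>M. walks_with_counts V (2 * r) n (g m) i)"
    using assms finM by (intro card_mono finite_UN_I finite_walks_with_counts)
  then have "real (card {xs. (i, xs) \<in> even_closed_walks V (2 * r) \<and> count_list xs = n})
      \<le> real (card (\<Union>m\<in>M. walks_with_counts V (2 * r) n (g m) i))"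
    by (rule of_nat_mono)
  also have "\<dots> \<le> (\<Sum>m\<in>M. real (card (walks_with_counts V (2 * r) n (g m) i)))"
    by (rule real_card_UN_le[OF finM])
  also have "\<dots> \<le> (\<Sum>m\<in>M. (\<Prod>v\<in>V. fact (n v)) * (\<Prod>e\<in>[V]\<^bsup>2\<^esup>. 2 ^ g m e / fact (g m e)))"
    using assms by (intro sum_mono card_walks_with_counts) (auto simp: g_def nsets_def)
  also have "\<dots> = (\<Sum>m\<in>M. (\<Prod>v\<in>V. fact (n v)) * (\<Prod>e\<in>[V]\<^bsup>2\<^esup>. 2 ^ (2 * m e) / fact (2 * m e)))"
    by (intro sum.cong arg_cong2[where f = "(*)"] prod.cong) (auto simp: g_def)
  also have "\<dots> \<le> (4 * exp 1 * real r) ^ r"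
    using sum_edge_multiplicities_bound[OF assms(1,3,4)] by (simp add: M_def)
  finally show ?thesis .
qed

text \<open>Every counted function has weight
  \<open>2 ^ L * (\<Prod>v\<in>V. (1/2) ^ n v) = 1\<close>. Summed over all functions, the weights
  factor into geometric sums, each at most 2.\<close>

lemma card_bounded_sum_functions:
  assumes "finite V"
  shows "real (card {n \<in> V \<rightarrow>\<^sub>E {..L}. (\<Sum>v\<in>V. n v) = L}) \<le> 2 ^ (L + card V)"
proof -
  let ?P = "{n \<in> V \<rightarrow>\<^sub>E {..L}. (\<Sum>v\<in>V. n v) = L}"
  have fin: "finite (V \<rightarrow>\<^sub>E {..L})"
    using assms by (intro finite_PiE) auto
  have "real (card ?P) = (\<Sum>n\<in>?P. 2 ^ L * (\<Prod>v\<in>V. (1/2) ^ n v))"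
    by (simp add: power_one_over prod_dividef flip: power_sum)
  also have "\<dots> \<le> (\<Sum>n\<in>V \<rightarrow>\<^sub>E {..L}. 2 ^ L * (\<Prod>v\<in>V. (1/2) ^ n v))"
    using fin by (intro sum_mono2) (auto intro!: mult_nonneg_nonneg prod_nonneg)
  also have "\<dots> = 2 ^ L * (\<Prod>v\<in>V. \<Sum>k\<le>L. (1/2) ^ k)"
    using assms by (subst prod_sum_PiE) (auto simp: sum_distrib_left)
  also have "\<dots> \<le> 2 ^ L * (\<Prod>v\<in>V. 2)"
  proof (intro mult_left_mono prod_mono conjI)
    show "(\<Sum>k\<le>L. (1/2::real) ^ k) \<le> 2"
      using sum_gp[of "1/2::real" 0 L] by (simp add: atLeast0AtMost)
  qed (auto intro: sum_nonneg)
  finally show ?thesis by (simp add: power_add)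
qed

text \<open>The three factors bound the number of starting vertices, of visit profiles, and of walks
  with a given start and profile.\<close>

lemma card_spanning_even_closed_walks:
  assumes "finite V" "r > 0"
  shows "real (card {(i, xs) \<in> even_closed_walks V (2 * r). set xs = V})
           \<le> real (card V) * 2 ^ (2 * r + card V) * (4 * exp 1 * real r) ^ r"
proof -
  define P where "P = {n \<in> V \<rightarrow>\<^sub>E {..2 * r}. (\<Sum>v\<in>V. n v) = 2 * r}"
  define ext where "ext = (\<lambda>n v. if v \<in> V then n v else (0::nat))"
  define W where "W = (\<lambda>(i, n). {xs. (i, xs) \<in> even_closed_walks V (2 * r) \<and> count_list xs = ext n})"
  have finP: "finite P"
    unfolding P_def using assms
    by (intro finite_subset[OF _ finite_PiE[of V "\<lambda>_. {..2 * r}"]]) auto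
  have finW: "finite (W a)" for a
    using assms by (intro finite_subset[OF _ finite_lists_length_eq[of V "2 * r"]])
      (auto simp: W_def even_closed_walks_def split: prod.splits)
  have "{(i, xs) \<in> even_closed_walks V (2 * r). set xs = V} \<subseteq> (\<Union>a\<in>V \<times> P. Pair (fst a) ` W a)"
  proof
    fix p assume "p \<in> {(i, xs) \<in> even_closed_walks V (2 * r). set xs = V}"
    then obtain i xs where p: "p = (i, xs)" and xs: "(i, xs) \<in> even_closed_walks V (2 * r)"
      and V: "V = set xs"
      by auto
    define n where "n = (\<lambda>v\<in>V. count_list xs v)"
    have len: "length xs = 2 * r" and i: "i \<in> V"
      using xs by (auto simp: even_closed_walks_def)
    have "(\<Sum>v\<in>V. count_list xs v) = 2 * r"
      using sum_count_set[of xs V] V len by simp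
    then have "n \<in> P"
      using count_le_length[of xs] len by (auto simp: P_def n_def)
    moreover have "ext n = count_list xs"
      using V by (auto simp: ext_def n_def fun_eq_iff count_list_0_iff)
    ultimately show "p \<in> (\<Union>a\<in>V \<times> P. Pair (fst a) ` W a)"
      using p xs i by (intro UN_I[of "(i, n)"]) (auto simp: W_def)
  qed
  then have "card {(i, xs) \<in> even_closed_walks V (2 * r). set xs = V}
      \<le> card (\<Union>a\<in>V \<times> P. Pair (fst a) ` W a)"
    by (rule card_mono[rotated]) (use assms finP finW in simp)
  then have "real (card {(i, xs) \<in> even_closed_walks V (2 * r). set xs = V})
      \<le> real (card (\<Union>a\<in>V \<times> P. Pair (fst a) ` W a))"
    by (rule of_nat_mono)
  also have "\<dots> \<le> (\<Sum>a\<in>V \<times> P. real (card (Pair (fst a) ` W a)))"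
    using assms finP by (intro real_card_UN_le) auto
  also have "\<dots> = (\<Sum>a\<in>V \<times> P. real (card (W a)))"
    by (intro sum.cong refl arg_cong[where f = real] card_image inj_onI) auto
  also have "\<dots> \<le> (\<Sum>a\<in>V \<times> P. (4 * exp 1 * real r) ^ r)"
  proof (intro sum_mono)
    fix a assume "a \<in> V \<times> P"
    then obtain i n where [simp]: "a = (i, n)" and i: "i \<in> V" and n: "n \<in> P" by auto
    have "(\<Sum>v\<in>V. ext n v) = 2 * r" using n by (simp add: ext_def P_def)
    then show "real (card (W a)) \<le> (4 * exp 1 * real r) ^ r"
      using card_even_closed_walks_profile[OF assms(1) i assms(2)] by (simp add: W_def)
  qed
  also have "\<dots> = real (card V) * real (card P) * (4 * exp 1 * real r) ^ r"
    by (simp add: card_cartesian_product)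
  also have "\<dots> \<le> real (card V) * 2 ^ (2 * r + card V) * (4 * exp 1 * real r) ^ r"
    using card_bounded_sum_functions[OF assms(1), of "2 * r"]
    by (intro mult_right_mono mult_left_mono) (auto simp: P_def)
  finally show ?thesis .
qed

text \<open>The start of a nonempty closed walk recurs in \<open>xs\<close>, so the connectivity
  bound applies to \<open>set xs\<close>; evenness forces every used edge to be traversed at least
  twice.\<close>

lemma card_vertices_even_closed_walk:
  assumes "(i, xs) \<in> even_closed_walks V (2 * r)" "r > 0"
  shows "card (set xs) \<le> card (set (walk_edges i xs)) + 1" "card (set (walk_edges i xs)) \<le> r"
proof -
  have "i \<in> set xs"
    using assms last_in_set[of xs] by (cases xs) (auto simp: even_closed_walks_def)
  then show "card (set xs) \<le> card (set (walk_edges i xs)) + 1"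
    using card_vertices_le_card_edges[of i xs] by (simp add: insert_absorb)
  have "2 * card (set (walk_edges i xs)) = (\<Sum>e\<in>set (walk_edges i xs). 2)"
    by simp
  also have "\<dots> \<le> (\<Sum>e\<in>set (walk_edges i xs). count_list (walk_edges i xs) e)"
  proof (intro sum_mono)
    fix e assume "e \<in> set (walk_edges i xs)"
    then have "count_list (walk_edges i xs) e \<noteq> 0" "even (count_list (walk_edges i xs) e)"
      using assms(1) by (auto simp: count_list_0_iff even_closed_walks_def)
    then show "2 \<le> count_list (walk_edges i xs) e"
      by (auto elim!: evenE)
  qed
  also have "\<dots> = 2 * r"
    using assms by (subst sum_count_set) (auto simp: even_closed_walks_def)
  finally show "card (set (walk_edges i xs)) \<le> r" by simp
qed

text \<open>Walks are grouped by vertex set and then by its size. The walk weights will have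
  \<open>q = 2 * p * (1 - p)\<close>, while \<open>Q = 2 * p\<close> gives a bound in terms of
  \<open>N * p\<close>.\<close>

lemma sum_even_closed_walks_bound:
  assumes "finite U" "r > 0" "0 \<le> q" "q \<le> 1" "q \<le> Q" "real r \<le> real (card U) * Q"
  shows "(\<Sum>(i, xs)\<in>even_closed_walks U (2 * r). q ^ card (set (walk_edges i xs)))
           \<le> 2 * real (card U) * (32 * (exp 1)\<^sup>2 * (real (card U) * Q)) ^ r"
proof -
  define N where "N = card U"
  define y where "y = real N * Q"
  have y: "y \<ge> real r" "y > 0" using assms by (auto simp: y_def N_def)
  define T where "T = {V \<in> Pow U. card V \<in> {1..r + 1}}"
  define c where "c = (\<lambda>t. real t * 2 ^ (2 * r + t) * (4 * exp 1 * real r) ^ r)"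
  let ?S = "even_closed_walks U (2 * r)"
  have c_nonneg: "c t \<ge> 0" for t by (simp add: c_def)
  have finS: "finite ?S" using assms(1) by (rule finite_even_closed_walks)
  have finT: "finite T" using assms(1) by (simp add: T_def)
  have start: "i \<in> set xs" if "(i, xs) \<in> ?S" for i xs
    using that assms(2) last_in_set[of xs] by (cases xs) (auto simp: even_closed_walks_def)
  have "(\<lambda>(i, xs). set xs) ` ?S \<subseteq> T"
  proof clarify
    fix i xs assume *: "(i, xs) \<in> ?S"
    have "card (set xs) > 0" using start[OF *] by (auto simp: card_gt_0_iff)
    then show "set xs \<in> T"
      using * card_vertices_even_closed_walk[OF * assms(2)]
      by (auto simp: T_def even_closed_walks_def)
  qed
  then have "(\<Sum>(i, xs)\<in>?S. q ^ card (set (walk_edges i xs)))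
      = (\<Sum>V\<in>T. \<Sum>(i, xs)\<in>{a \<in> ?S. (\<lambda>(i, xs). set xs) a = V}. q ^ card (set (walk_edges i xs)))"
    by (rule sum.group[OF finS finT, symmetric])
  \<comment> \<open>The exponent is first lowered from the number of edges to
    \<open>card V - 1\<close>, using \<open>q \<le> 1\<close>; only then is \<open>q\<close>
    replaced by \<open>Q\<close>, which may exceed 1.\<close>
  also have "\<dots> \<le> (\<Sum>V\<in>T. \<Sum>(i, xs)\<in>{a \<in> ?S. (\<lambda>(i, xs). set xs) a = V}. Q ^ (card V - 1))"
  proof (intro sum_mono, clarify)
    fix i xs assume "(i, xs) \<in> ?S"
    then have "q ^ card (set (walk_edges i xs)) \<le> q ^ (card (set xs) - 1)"
      using card_vertices_even_closed_walk(1)[of i xs U r] assms by (intro power_decreasing) auto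
    also have "\<dots> \<le> Q ^ (card (set xs) - 1)"
      using assms by (intro power_mono)
    finally show "q ^ card (set (walk_edges i xs)) \<le> Q ^ (card (set xs) - 1)" .
  qed
  also have "\<dots> = (\<Sum>V\<in>T. real (card {a \<in> ?S. (\<lambda>(i, xs). set xs) a = V}) * Q ^ (card V - 1))"
    by (simp add: case_prod_unfold)
  also have "\<dots> \<le> (\<Sum>V\<in>T. c (card V) * Q ^ (card V - 1))"
  proof (intro sum_mono mult_right_mono)
    fix V assume V: "V \<in> T"
    then have finV: "finite V" using assms(1) by (auto simp: T_def intro: finite_subset)
    have "{a \<in> ?S. (\<lambda>(i, xs). set xs) a = V} \<subseteq> {(i, xs) \<in> even_closed_walks V (2 * r). set xs = V}"
      using start by (auto simp: even_closed_walks_def)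
    moreover have "finite {(i, xs) \<in> even_closed_walks V (2 * r). set xs = V}"
      by (rule finite_subset[OF _ finite_even_closed_walks[OF finV]]) auto
    ultimately have "card {a \<in> ?S. (\<lambda>(i, xs). set xs) a = V}
        \<le> card {(i, xs) \<in> even_closed_walks V (2 * r). set xs = V}"
      by (intro card_mono)
    then show "real (card {a \<in> ?S. (\<lambda>(i, xs). set xs) a = V}) \<le> c (card V)"
      using card_spanning_even_closed_walks[OF finV assms(2)] unfolding c_def by linarith
  qed (use assms in auto)
  also have "\<dots> = (\<Sum>t\<in>{1..r + 1}. \<Sum>V\<in>{V \<in> T. card V = t}. c (card V) * Q ^ (card V - 1))"
    by (rule sum.group[OF finT, symmetric]) (auto simp: T_def)
  also have "\<dots> = (\<Sum>t\<in>{1..r + 1}. real (N choose t) * (c t * Q ^ (t - 1)))"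
  proof (intro sum.cong refl)
    fix t assume "t \<in> {1..r + 1}"
    then have "{V \<in> T. card V = t} = {V. V \<subseteq> U \<and> card V = t}" by (auto simp: T_def)
    then show "(\<Sum>V\<in>{V \<in> T. card V = t}. c (card V) * Q ^ (card V - 1))
        = real (N choose t) * (c t * Q ^ (t - 1))"
      using n_subsets[OF assms(1), of t] by (simp add: N_def)
  qed
  also have "\<dots> = (\<Sum>j\<le>r. real (N choose Suc j) * (c (Suc j) * Q ^ j))"
    by (rule sum.reindex_bij_witness[of _ Suc "\<lambda>t. t - 1"]) auto
  \<comment> \<open>The factor \<open>Suc j\<close> in \<open>c (Suc j)\<close> is absorbed by the
    binomial coefficient, leaving \<open>N ^ Suc j / fact j\<close>, and \<open>r \<le> y\<close>
    gives \<open>y ^ j * r ^ r \<le> y ^ r * r ^ j\<close>, so that an exponential series in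
    \<open>r\<close> remains. The constant 32 is \<open>8 * 4\<close>, from
    \<open>2 ^ (3 * r + 1)\<close> and \<open>(4 * exp 1 * r) ^ r\<close>.\<close>
  also have "\<dots> \<le> (\<Sum>j\<le>r. 2 * real N * (32 * exp 1 * y) ^ r * (real r ^ j / fact j))"
  proof (intro sum_mono)
    fix j assume "j \<in> {..r}"
    then have j: "j \<le> r" by simp
    have "real (N choose Suc j) * fact (Suc j) \<le> real N ^ Suc j"
      using binomial_fact_pow[of N "Suc j"] by (metis of_nat_fact of_nat_le_iff of_nat_mult of_nat_power)
    then have 1: "real (N choose Suc j) * real (Suc j) \<le> real N ^ Suc j / fact j"
      by (simp add: field_simps)
    have "real r ^ r = real r ^ j * real r ^ (r - j)"
      using j by (simp flip: power_add)
    also have "\<dots> \<le> real r ^ j * y ^ (r - j)"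
      using y by (intro mult_left_mono power_mono) auto
    finally have "y ^ j * real r ^ r \<le> y ^ j * (real r ^ j * y ^ (r - j))"
      using y by (intro mult_left_mono) auto
    also have "\<dots> = y ^ r * real r ^ j"
      using j by (simp flip: power_add)
    finally have 2: "y ^ j * real r ^ r \<le> y ^ r * real r ^ j" .
    have "real (N choose Suc j) * (c (Suc j) * Q ^ j)
        = (real (N choose Suc j) * real (Suc j)) * (2 ^ (2 * r + Suc j) * (4 * exp 1 * real r) ^ r * Q ^ j)"
      by (simp add: c_def mult_ac)
    also have "\<dots> \<le> (real N ^ Suc j / fact j) * (2 ^ (2 * r + (r + 1)) * (4 * exp 1 * real r) ^ r * Q ^ j)"
      using assms j by (intro mult_mono 1 mult_right_mono) (auto intro!: mult_nonneg_nonneg power_increasing)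
    also have "\<dots> = 2 * real N * (32 * exp 1) ^ r * (y ^ j * real r ^ r) / fact j"
    proof -
      have "(2::real) ^ (2 * r + (r + 1)) = 2 * 8 ^ r"
        by (simp add: power_add power_mult flip: power_mult_distrib)
      moreover have "(8::real) ^ r * (4 * exp 1 * real r) ^ r = (32 * exp 1) ^ r * real r ^ r"
      proof -
        have "(8::real) ^ r * 4 ^ r = 32 ^ r"
          by (simp flip: power_mult_distrib)
        then show ?thesis
          by (simp only: power_mult_distrib mult.assoc[symmetric])
      qed
      moreover have "real N ^ Suc j * Q ^ j = real N * y ^ j"
        by (simp add: y_def power_mult_distrib)
      moreover have "(real N ^ Suc j / fact j) * (2 ^ (2 * r + (r + 1)) * (4 * exp 1 * real r) ^ r * Q ^ j)
          = (real N ^ Suc j * Q ^ j) * 2 ^ (2 * r + (r + 1)) * (4 * exp 1 * real r) ^ r / fact j"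
        by (simp only: times_divide_eq_left times_divide_eq_right mult_ac)
      ultimately show ?thesis
        by (simp only: mult.assoc mult.left_commute)
    qed
    also have "\<dots> \<le> 2 * real N * (32 * exp 1) ^ r * (y ^ r * real r ^ j) / fact j"
      by (intro divide_right_mono mult_left_mono 2) auto
    also have "\<dots> = 2 * real N * (32 * exp 1 * y) ^ r * (real r ^ j / fact j)"
      by (simp add: power_mult_distrib)
    finally show "real (N choose Suc j) * (c (Suc j) * Q ^ j)
        \<le> 2 * real N * (32 * exp 1 * y) ^ r * (real r ^ j / fact j)" .
  qed
  also have "\<dots> = 2 * real N * (32 * exp 1 * y) ^ r * (\<Sum>j\<le>r. real r ^ j / fact j)"
    by (simp add: sum_distrib_left)
  \<comment> \<open>The truncated series costs \<open>exp r\<close>, which is the second factor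
    \<open>exp 1\<close> inside the power.\<close>
  also have "\<dots> \<le> 2 * real N * (32 * exp 1 * y) ^ r * exp (real r)"
    using y by (intro mult_left_mono sum_power_div_fact_le_exp) auto
  also have "\<dots> = 2 * real N * (32 * (exp 1)\<^sup>2 * y) ^ r"
  proof -
    have "exp (real r) = exp 1 ^ r"
      using exp_of_nat_mult[of r "1::real"] by simp
    then show ?thesis
      by (simp only: power_mult_distrib power2_eq_square mult.assoc mult.left_commute)
         (simp add: mult_ac)
  qed
  finally show ?thesis by (simp add: N_def y_def)
qed

subsection \<open>Traces of powers as sums over closed walks\<close>

text \<open>This is the \<open>(i, j)\<close> entry of the \<open>L\<close>-th power of the matrix
  with entries \<open>y {i, j}\<close>. Indexing by unordered pairs makes the matrix symmetric, with
  \<open>y\<close> on singletons as its diagonal.\<close>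

primrec walk_sum :: "('a set \<Rightarrow> real) \<Rightarrow> 'a set \<Rightarrow> nat \<Rightarrow> 'a \<Rightarrow> 'a \<Rightarrow> real" where
  "walk_sum y V 0 i j = of_bool (i = j)"
| "walk_sum y V (Suc L) i j = (\<Sum>k\<in>V. y {i, k} * walk_sum y V L k j)"

lemma walk_sum_1:
  assumes "finite V" "j \<in> V"
  shows "walk_sum y V (Suc 0) i j = y {i, j}"
proof -
  have "walk_sum y V (Suc 0) i j = (\<Sum>k\<in>V. if k = j then y {i, k} else 0)"
    unfolding walk_sum.simps by (intro sum.cong) auto
  then show ?thesis using assms by simp
qed

lemma walk_sum_eq:
  assumes "finite V" "i \<in> V"
  shows "walk_sum y V L i j
    = (\<Sum>xs | length xs = L \<and> set xs \<subseteq> V \<and> last (i # xs) = j. prod_list (map y (walk_edges i xs)))"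
  using assms(2)
proof (induction L arbitrary: i)
  case 0
  have "{xs. length xs = 0 \<and> set xs \<subseteq> V \<and> last (i # xs) = j} = (if i = j then {[]} else {})"
    by auto
  then show ?case by auto
next
  case (Suc L)
  define A where "A = (\<lambda>k. {xs. length xs = L \<and> set xs \<subseteq> V \<and> last (k # xs) = j})"
  have finA: "finite (A k)" for k
    by (rule finite_subset[OF _ finite_lists_length_eq[OF assms(1), of L]]) (auto simp: A_def)
  have *: "{xs. length xs = Suc L \<and> set xs \<subseteq> V \<and> last (i # xs) = j}
      = (\<lambda>(k, xs). k # xs) ` (SIGMA k:V. A k)"
    by (auto simp: A_def image_iff length_Suc_conv split: if_splits)
  have "(\<Sum>xs | length xs = Suc L \<and> set xs \<subseteq> V \<and> last (i # xs) = j. prod_list (map y (walk_edges i xs)))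
      = (\<Sum>(k, xs)\<in>(SIGMA k:V. A k). y {i, k} * prod_list (map y (walk_edges k xs)))"
    unfolding * by (subst sum.reindex) (auto simp: inj_on_def case_prod_unfold)
  also have "\<dots> = (\<Sum>k\<in>V. \<Sum>xs\<in>A k. y {i, k} * prod_list (map y (walk_edges k xs)))"
    using assms(1) finA by (intro sum.Sigma[symmetric]) auto
  also have "\<dots> = walk_sum y V (Suc L) i j"
    using Suc.IH by (simp add: A_def sum_distrib_left)
  finally show ?case by simp
qed

lemma walk_sum_add:
  assumes "finite V" "i \<in> V"
  shows "walk_sum y V (a + b) i j = (\<Sum>k\<in>V. walk_sum y V a i k * walk_sum y V b k j)"
  using assms(2)
proof (induction a arbitrary: i)
  case 0
  then show ?case using assms(1) by simp
next
  case (Suc a)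
  have "walk_sum y V (Suc a + b) i j
      = (\<Sum>l\<in>V. \<Sum>k\<in>V. y {i, l} * walk_sum y V a l k * walk_sum y V b k j)"
    using Suc by (simp add: sum_distrib_left mult.assoc)
  also have "\<dots> = (\<Sum>k\<in>V. \<Sum>l\<in>V. y {i, l} * walk_sum y V a l k * walk_sum y V b k j)"
    by (rule sum.swap)
  finally show ?case by (simp add: sum_distrib_right)
qed

lemma walk_sum_commute:
  assumes "finite V" "i \<in> V" "j \<in> V"
  shows "walk_sum y V L i j = walk_sum y V L j i"
  using assms(2,3)
proof (induction L arbitrary: i j)
  case (Suc L)
  have "walk_sum y V (Suc L) i j = (\<Sum>k\<in>V. walk_sum y V L i k * walk_sum y V (Suc 0) k j)"
    using walk_sum_add[OF assms(1) Suc.prems(1), of y L "Suc 0" j] by simp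
  also have "\<dots> = (\<Sum>k\<in>V. walk_sum y V L k i * y {j, k})"
    using Suc by (intro sum.cong) (auto simp: walk_sum_1[OF assms(1)] insert_commute simp del: walk_sum.simps)
  finally show ?case by (simp add: mult.commute)
qed auto

text \<open>By symmetry, \<open>Y^(2L)\<close> is the Gram matrix of the columns of
  \<open>Y^L\<close>.\<close>

lemma walk_sum_double:
  assumes "finite V" "i \<in> V" "j \<in> V"
  shows "walk_sum y V (2 * L) i j = (\<Sum>k\<in>V. walk_sum y V L k i * walk_sum y V L k j)"
proof -
  have "walk_sum y V (2 * L) i j = (\<Sum>k\<in>V. walk_sum y V L i k * walk_sum y V L k j)"
    unfolding mult_2 by (rule walk_sum_add[OF assms(1,2)])
  also have "\<dots> = (\<Sum>k\<in>V. walk_sum y V L k i * walk_sum y V L k j)"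
    by (rule sum.cong[OF refl]) (simp add: walk_sum_commute[OF assms(1,2)])
  finally show ?thesis .
qed

text \<open>The squared Frobenius norm of \<open>Y^L\<close>; in particular traces of even powers
  are nonnegative.\<close>

lemma trace_walk_sum_double:
  assumes "finite V"
  shows "(\<Sum>i\<in>V. walk_sum y V (2 * L) i i) = (\<Sum>i\<in>V. \<Sum>k\<in>V. (walk_sum y V L k i)\<^sup>2)"
  by (rule sum.cong[OF refl]) (simp only: walk_sum_double[OF assms] power2_eq_square)

text \<open>Since the exponent is a power of two, repeated application of Cauchy-Schwarz replaces the
  spectral theorem.\<close>

lemma quadratic_form_pow_le_trace:
  assumes "finite V" "I \<subseteq> V" "m > 0"
  shows "(\<Sum>i\<in>I. \<Sum>j\<in>I. y {i, j}) ^ 2 ^ m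
           \<le> real (card I) ^ 2 ^ m * (\<Sum>i\<in>V. walk_sum y V (2 ^ m) i i)"
proof -
  \<comment> \<open>\<open>Q L\<close> is the quadratic form \<open>x^T Y^L x\<close> of the
    indicator vector \<open>x\<close> of \<open>I\<close>, and \<open>s\<close> is
    \<open>x^T x\<close>.\<close>
  define Q where "Q = (\<lambda>L. \<Sum>i\<in>I. \<Sum>j\<in>I. walk_sum y V L i j)"
  define s where "s = real (card I)"
  have finI: "finite I" and inV: "\<And>i. i \<in> I \<Longrightarrow> i \<in> V"
    using assms finite_subset by auto
  have Q_double: "Q (2 * L) = (\<Sum>k\<in>V. (\<Sum>i\<in>I. walk_sum y V L k i)\<^sup>2)" for L
  proof -
    have "Q (2 * L) = (\<Sum>i\<in>I. \<Sum>j\<in>I. \<Sum>k\<in>V. walk_sum y V L k i * walk_sum y V L k j)"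
      unfolding Q_def using assms(1) inV by (intro sum.cong refl walk_sum_double) auto
    also have "\<dots> = (\<Sum>i\<in>I. \<Sum>k\<in>V. \<Sum>j\<in>I. walk_sum y V L k i * walk_sum y V L k j)"
      by (intro sum.cong refl sum.swap)
    also have "\<dots> = (\<Sum>k\<in>V. \<Sum>i\<in>I. \<Sum>j\<in>I. walk_sum y V L k i * walk_sum y V L k j)"
      by (rule sum.swap)
    finally show ?thesis by (simp add: power2_eq_square sum_product)
  qed
  \<comment> \<open>Cauchy-Schwarz against \<open>x\<close>; the coordinates of \<open>Y^L x\<close>
    outside \<open>I\<close> only add nonnegative squares.\<close>
  have square: "(Q L)\<^sup>2 \<le> s * Q (2 * L)" for L
  proof -
    have "(Q L)\<^sup>2 \<le> (\<Sum>k\<in>I. 1\<^sup>2) * (\<Sum>k\<in>I. (\<Sum>i\<in>I. walk_sum y V L k i)\<^sup>2)"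
      using Cauchy_Schwarz_ineq_sum[of "\<lambda>_. 1" "\<lambda>k. \<Sum>i\<in>I. walk_sum y V L k i" I]
      by (simp add: Q_def)
    also have "\<dots> \<le> s * Q (2 * L)"
      unfolding Q_double s_def using assms by (auto intro!: mult_left_mono sum_mono2)
    finally show ?thesis .
  qed
  have iter: "(Q 1) ^ 2 ^ m \<le> s ^ (2 ^ m - 1) * Q (2 ^ m)" if "m > 0" for m :: nat
    using that
  proof (induction m rule: nat_induct_non_zero)
    case 1
    then show ?case using square[of 1] by simp
  next
    case (Suc m)
    have "(Q 1) ^ 2 ^ Suc m = ((Q 1) ^ 2 ^ m)\<^sup>2"
      by (simp only: power_Suc power_even_eq)
    \<comment> \<open>Squaring the inequality needs a nonnegative left side, which holds because
      \<open>m > 0\<close> makes the exponent \<open>2 ^ m\<close> even.\<close>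
    also have "\<dots> \<le> (s ^ (2 ^ m - 1) * Q (2 ^ m))\<^sup>2"
      using Suc by (intro power_mono) (auto simp: zero_le_even_power)
    also have "\<dots> = s ^ (2 * (2 ^ m - 1)) * (Q (2 ^ m))\<^sup>2"
      by (simp only: power_mult_distrib power_even_eq)
    also have "\<dots> \<le> s ^ (2 * (2 ^ m - 1)) * (s * Q (2 * 2 ^ m))"
      by (intro mult_left_mono square) (auto simp: s_def)
    also have "\<dots> = s ^ (2 * (2 ^ m - 1) + 1) * Q (2 ^ Suc m)"
      by simp
    also have "2 * (2 ^ m - 1) + 1 = (2 ^ Suc m - 1 :: nat)"
    proof -
      have "(2::nat) ^ m \<ge> 1" by simp
      then show ?thesis unfolding power_Suc by linarith
    qed
    finally show ?case .
  qed
  obtain m' where m': "m = Suc m'" using assms(3) by (cases m) auto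
  \<comment> \<open>With \<open>L = 2 ^ m'\<close>, Cauchy-Schwarz in each coordinate bounds
    \<open>|Y^L x|^2\<close> by \<open>s\<close> times the squared Frobenius norm of
    \<open>Y^L\<close>, which is the trace of \<open>Y^(2L)\<close>.\<close>
  have "Q (2 ^ m) \<le> (\<Sum>k\<in>V. s * (\<Sum>i\<in>V. (walk_sum y V (2 ^ m') k i)\<^sup>2))"
    unfolding m' power_Suc Q_double
  proof (intro sum_mono)
    fix k assume "k \<in> V"
    have "(\<Sum>i\<in>I. 1 * walk_sum y V (2 ^ m') k i)\<^sup>2
        \<le> (\<Sum>i\<in>I. 1\<^sup>2) * (\<Sum>i\<in>I. (walk_sum y V (2 ^ m') k i)\<^sup>2)"
      by (rule Cauchy_Schwarz_ineq_sum)
    also have "\<dots> \<le> s * (\<Sum>i\<in>V. (walk_sum y V (2 ^ m') k i)\<^sup>2)"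
      unfolding s_def using assms by (auto intro!: mult_left_mono sum_mono2)
    finally show "(\<Sum>i\<in>I. walk_sum y V (2 ^ m') k i)\<^sup>2 \<le> s * (\<Sum>i\<in>V. (walk_sum y V (2 ^ m') k i)\<^sup>2)"
      by simp
  qed
  also have "\<dots> = s * (\<Sum>i\<in>V. walk_sum y V (2 ^ m) i i)"
    unfolding m' power_Suc trace_walk_sum_double[OF assms(1)] sum_distrib_left[symmetric]
    by (subst sum.swap) simp
  finally have "(Q 1) ^ 2 ^ m \<le> s ^ (2 ^ m - 1) * (s * (\<Sum>i\<in>V. walk_sum y V (2 ^ m) i i))"
    by (intro order_trans[OF iter[OF assms(3)] mult_left_mono]) (simp_all add: s_def)
  also have "\<dots> = s ^ (2 ^ m - 1 + 1) * (\<Sum>i\<in>V. walk_sum y V (2 ^ m) i i)"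
    by (simp only: power_add power_one_right mult.assoc)
  also have "2 ^ m - 1 + 1 = (2 ^ m :: nat)" by simp
  also have "Q 1 = (\<Sum>i\<in>I. \<Sum>j\<in>I. y {i, j})"
    unfolding Q_def using inV
    by (intro sum.cong) (auto simp: walk_sum_1[OF assms(1)] simp del: walk_sum.simps)
  finally show ?thesis by (simp add: s_def)
qed

subsection \<open>The symmetrized adjacency matrix\<close>

lemma singleton_notin_nsets_2: "{v} \<notin> [V]\<^bsup>2\<^esup>"
  by (simp add: nsets_def)

section \<open>Expected products of entries of the symmetrized matrix\<close>

lemma prod_list_map_eq_prod_count:
  fixes f :: "'a \<Rightarrow> 'b::comm_monoid_mult"
  shows "prod_list (map f xs) = (\<Prod>x\<in>set xs. f x ^ count_list xs x)"
proof (induction xs)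
  case (Cons x xs)
  have "(\<Prod>y\<in>set (x # xs). f y ^ count_list (x # xs) y)
      = (\<Prod>y\<in>insert x (set xs). (if y = x then f x else 1) * f y ^ count_list xs y)"
    by (rule prod.cong) auto
  also have "\<dots> = f x * (\<Prod>y\<in>insert x (set xs). f y ^ count_list xs y)"
    by (simp add: prod.distrib)
  also have "(\<Prod>y\<in>insert x (set xs). f y ^ count_list xs y) = (\<Prod>y\<in>set xs. f y ^ count_list xs y)"
    by (cases "x \<in> set xs") (auto simp: insert_absorb)
  finally show ?case using Cons by simp
qed simp

text \<open>Each factor is affine in the indicator of its edge, so independence of the indicators
  passes to the factors.\<close>

lemma expectation_edge_prod:
  fixes G :: "'e set pmf" and \<alpha> \<beta> :: "'e \<Rightarrow> real"
  assumes "finite F"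
    and indep: "prob_space.indep_vars (measure_pmf G) (\<lambda>_. borel) (\<lambda>e E. indicator E e :: real) F"
    and prob: "\<And>e. e \<in> F \<Longrightarrow> measure_pmf.prob G {E. e \<in> E} = p"
  shows "measure_pmf.expectation G (\<lambda>E. \<Prod>e\<in>F. if e \<in> E then \<alpha> e else \<beta> e)
           = (\<Prod>e\<in>F. p * \<alpha> e + (1 - p) * \<beta> e)"
proof -
  define X where "X = (\<lambda>e E. \<beta> e + (\<alpha> e - \<beta> e) * indicator E e)"
  have "prob_space.indep_vars (measure_pmf G) (\<lambda>_. borel) X F"
    unfolding X_def
    by (rule prob_space.indep_vars_compose2[OF measure_pmf.prob_space_axioms indep, where Y = "\<lambda>e x. \<beta> e + (\<alpha> e - \<beta> e) * x"]) simp
  moreover have "integrable (measure_pmf G) (X e)" for e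
    by (rule measure_pmf.integrable_const_bound[of _ "\<bar>\<beta> e\<bar> + \<bar>\<alpha> e\<bar>"])
       (auto simp: X_def indicator_def)
  ultimately have "measure_pmf.expectation G (\<lambda>E. \<Prod>e\<in>F. X e E) = (\<Prod>e\<in>F. measure_pmf.expectation G (X e))"
    using assms(1) by (intro prob_space.indep_vars_lebesgue_integral measure_pmf.prob_space_axioms)
  moreover have "measure_pmf.expectation G (X e) = p * \<alpha> e + (1 - p) * \<beta> e" if "e \<in> F" for e
  proof -
    have "X e = (\<lambda>E. \<beta> e + (\<alpha> e - \<beta> e) * indicator {E. e \<in> E} E)"
      by (auto simp: X_def indicator_def fun_eq_iff)
    moreover have "integrable (measure_pmf G) (indicator {E. e \<in> E} :: _ \<Rightarrow> real)"
      by (rule measure_pmf.integrable_const_bound[of _ 1]) auto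
    ultimately have "measure_pmf.expectation G (X e) = \<beta> e + (\<alpha> e - \<beta> e) * measure_pmf.prob G {E. e \<in> E}"
      by simp
    then show ?thesis using prob[OF that] by (simp add: algebra_simps)
  qed
  moreover have "(\<Prod>e\<in>F. X e E) = (\<Prod>e\<in>F. if e \<in> E then \<alpha> e else \<beta> e)" for E
    by (intro prod.cong) (auto simp: X_def)
  ultimately show ?thesis by simp
qed

definition edge_difference :: "'e set \<Rightarrow> 'e set \<Rightarrow> 'e \<Rightarrow> real" where
  "edge_difference E E' e = of_bool (e \<in> E') - of_bool (e \<in> E)"

text \<open>The independent copy is modelled by an iterated expectation. Averaging over
  \<open>E'\<close> turns the factor of an edge of multiplicity \<open>c\<close> into
  \<open>(1 - p) * (-1) ^ c\<close> if it lies in \<open>E\<close> and into \<open>p\<close>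
  otherwise; averaging over \<open>E\<close> leaves \<open>p * (1 - p) * (1 + (-1) ^ c)\<close>,
  which vanishes for odd \<open>c\<close>.\<close>

lemma expectation_edge_difference_prod:
  fixes G :: "'e set pmf"
  assumes indep: "prob_space.indep_vars (measure_pmf G) (\<lambda>_. borel) (\<lambda>e E. indicator E e :: real) (set es)"
    and prob: "\<And>e. e \<in> set es \<Longrightarrow> measure_pmf.prob G {E. e \<in> E} = p"
  shows "measure_pmf.expectation G (\<lambda>E. measure_pmf.expectation G
             (\<lambda>E'. prod_list (map (edge_difference E E') es)))
           = (if \<forall>e. even (count_list es e) then (2 * p * (1 - p)) ^ card (set es) else 0)"
proof -
  let ?c = "count_list es"
  have "measure_pmf.expectation G (\<lambda>E'. prod_list (map (edge_difference E E') es))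
      = (\<Prod>e\<in>set es. if e \<in> E then (1 - p) * (- 1) ^ ?c e else p)" for E
  proof -
    have "measure_pmf.expectation G (\<lambda>E'. prod_list (map (edge_difference E E') es))
        = measure_pmf.expectation G (\<lambda>E'. \<Prod>e\<in>set es.
             if e \<in> E' then (1 - of_bool (e \<in> E)) ^ ?c e else (- of_bool (e \<in> E)) ^ ?c e)"
      unfolding prod_list_map_eq_prod_count edge_difference_def
      by (intro Bochner_Integration.integral_cong prod.cong) auto
    also have "\<dots> = (\<Prod>e\<in>set es. p * (1 - of_bool (e \<in> E)) ^ ?c e + (1 - p) * (- of_bool (e \<in> E)) ^ ?c e)"
      using assms by (intro expectation_edge_prod) auto
    \<comment> \<open>Every entry of \<open>es\<close> has positive multiplicity, so the powers of 0
      are 0.\<close>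
    also have "\<dots> = (\<Prod>e\<in>set es. if e \<in> E then (1 - p) * (- 1) ^ ?c e else p)"
      by (intro prod.cong) (auto simp: zero_power count_list_0_iff)
    finally show ?thesis .
  qed
  then have "measure_pmf.expectation G (\<lambda>E. measure_pmf.expectation G
             (\<lambda>E'. prod_list (map (edge_difference E E') es)))
      = (\<Prod>e\<in>set es. p * ((1 - p) * (- 1) ^ ?c e) + (1 - p) * p)"
    using assms by (simp only:, intro expectation_edge_prod) auto
  also have "\<dots> = (\<Prod>e\<in>set es. if even (?c e) then 2 * p * (1 - p) else 0)"
    by (intro prod.cong) (auto simp: algebra_simps)
  also have "\<dots> = (if \<forall>e. even (?c e) then (2 * p * (1 - p)) ^ card (set es) else 0)"
  proof (cases "\<forall>e. even (?c e)")
    case False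
    then obtain e where "odd (?c e)" by auto
    moreover from this have "e \<in> set es"
      using count_list_0_iff[of es e] by (metis even_zero)
    ultimately have "\<exists>e\<in>set es. (if even (?c e) then 2 * p * (1 - p) else 0) = 0"
      by (intro bexI[of _ e]) auto
    then show ?thesis using False by (subst prod_zero) auto
  qed simp
  finally show ?thesis .
qed

text \<open>The trace expands into closed walks of length \<open>L\<close>; these use at most
  \<open>L\<close> distinct edges, so the limited independence suffices.\<close>

lemma expectation_trace_edge_difference:
  fixes G :: "'a set set pmf"
  assumes "finite V" "set_pmf G \<subseteq> Pow ([V]\<^bsup>2\<^esup>)"
    and indep: "\<And>F. F \<subseteq> [V]\<^bsup>2\<^esup> \<Longrightarrow> card F \<le> L \<Longrightarrow>
      prob_space.indep_vars (measure_pmf G) (\<lambda>_. borel) (\<lambda>e E. indicator E e :: real) F"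
    and prob: "\<And>e. e \<in> [V]\<^bsup>2\<^esup> \<Longrightarrow> measure_pmf.prob G {E. e \<in> E} = p"
  shows "measure_pmf.expectation G (\<lambda>E. measure_pmf.expectation G
             (\<lambda>E'. \<Sum>i\<in>V. walk_sum (edge_difference E E') V L i i))
           = (\<Sum>(i, xs)\<in>even_closed_walks V L. (2 * p * (1 - p)) ^ card (set (walk_edges i xs)))"
proof -
  define W where "W = (SIGMA i:V. {xs. length xs = L \<and> set xs \<subseteq> V \<and> last (i # xs) = i})"
  have finW: "finite W"
    by (rule finite_subset[of _ "V \<times> {xs. set xs \<subseteq> V \<and> length xs = L}"])
       (use assms(1) in \<open>auto simp: W_def finite_lists_length_eq\<close>)
  have fin: "finite (set_pmf G)"
    using assms(1,2) by (auto intro: finite_subset simp: finite_imp_finite_nsets)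
  have int: "integrable (measure_pmf G) f" for f :: "'a set set \<Rightarrow> real"
    by (rule integrable_measure_pmf_finite[OF fin])
  let ?w = "\<lambda>E E' (i, xs). prod_list (map (edge_difference E E') (walk_edges i xs))"
  have trace: "(\<Sum>i\<in>V. walk_sum (edge_difference E E') V L i i) = (\<Sum>a\<in>W. ?w E E' a)" for E E' :: "'a set set"
  proof -
    have "finite {xs. length xs = L \<and> set xs \<subseteq> V \<and> last (i # xs) = i}" for i
      by (rule finite_subset[OF _ finite_lists_length_eq[OF assms(1), of L]]) auto
    then show ?thesis
      unfolding W_def using assms(1) by (simp add: walk_sum_eq sum.Sigma)
  qed
  have "measure_pmf.expectation G (\<lambda>E. measure_pmf.expectation G
             (\<lambda>E'. \<Sum>i\<in>V. walk_sum (edge_difference E E') V L i i))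
      = (\<Sum>a\<in>W. measure_pmf.expectation G (\<lambda>E. measure_pmf.expectation G (\<lambda>E'. ?w E E' a)))"
    unfolding trace by (simp add: Bochner_Integration.integral_sum int)
  also have "\<dots> = (\<Sum>a\<in>W. if a \<in> even_closed_walks V L
      then (2 * p * (1 - p)) ^ card (set (walk_edges (fst a) (snd a))) else 0)"
  proof (intro sum.cong refl)
    fix a assume "a \<in> W"
    then obtain i xs where [simp]: "a = (i, xs)" and i: "i \<in> V"
      and xs: "length xs = L" "set xs \<subseteq> V" "last (i # xs) = i"
      by (auto simp: W_def)
    show "measure_pmf.expectation G (\<lambda>E. measure_pmf.expectation G (\<lambda>E'. ?w E E' a))
        = (if a \<in> even_closed_walks V L
           then (2 * p * (1 - p)) ^ card (set (walk_edges (fst a) (snd a))) else 0)"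
    \<comment> \<open>A loop contributes a factor 0, because no graph in the support contains a
      singleton.\<close>
    proof (cases "\<exists>v. {v} \<in> set (walk_edges i xs)")
      case True
      then obtain v where v: "{v} \<in> set (walk_edges i xs)" by auto
      have notin: "{v} \<notin> E" if "E \<in> set_pmf G" for E
        using subsetD[OF assms(2) that] singleton_notin_nsets_2[of _ V] by auto
      have "prod_list (map (edge_difference E E') (walk_edges i xs)) = 0"
        if "E \<in> set_pmf G" "E' \<in> set_pmf G" for E E'
        using v notin[OF that(1)] notin[OF that(2)]
        by (subst prod_list_zero_iff) (auto simp: edge_difference_def intro!: image_eqI[of _ _ "{v}"])
      then have "measure_pmf.expectation G (\<lambda>E. measure_pmf.expectation G (\<lambda>E'. ?w E E' a))
          = measure_pmf.expectation G (\<lambda>E. 0)"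
        by (intro integral_cong_AE) (auto simp: AE_measure_pmf_iff intro!: integral_eq_zero_AE)
      then show ?thesis using v by (auto simp: even_closed_walks_def)
    next
      case False
      then have sub: "set (walk_edges i xs) \<subseteq> [V]\<^bsup>2\<^esup>"
        by (intro walk_edges_in_nsets[OF i xs(2)]) auto
      have "card (set (walk_edges i xs)) \<le> L"
        using card_length[of "walk_edges i xs"] xs by simp
      note expectation_edge_difference_prod[OF indep[OF sub this] prob[OF subsetD[OF sub]]]
      then show ?thesis
        using False i xs by (auto simp: even_closed_walks_def)
    qed
  qed
  also have "\<dots> = (\<Sum>(i, xs)\<in>even_closed_walks V L. (2 * p * (1 - p)) ^ card (set (walk_edges i xs)))"
    by (rule sum.mono_neutral_cong_right[OF finW]) (auto simp: W_def even_closed_walks_def)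
  finally show ?thesis .
qed

text \<open>Only \<open>E'\<close> is random here. As \<open>I\<close> is independent in
  \<open>E\<close>, the matrix entries at distinct vertices of \<open>I\<close> are just indicators
  for \<open>E'\<close>, so the quadratic form of \<open>I\<close> has mean
  \<open>p * s * (s - 1)\<close> with \<open>s = card I\<close>.\<close>

lemma expectation_trace_lower_bound:
  fixes G :: "'a set set pmf"
  assumes "finite V" "set_pmf G \<subseteq> Pow ([V]\<^bsup>2\<^esup>)" "m > 0"
    and prob: "\<And>e. e \<in> [V]\<^bsup>2\<^esup> \<Longrightarrow> measure_pmf.prob G {E. e \<in> E} = p"
    and E: "E \<in> set_pmf G" and I: "I \<subseteq> V" "indep I E" "I \<noteq> {}"
  shows "(p * (real (card I) - 1)) ^ 2 ^ m
           \<le> measure_pmf.expectation G (\<lambda>E'. \<Sum>i\<in>V. walk_sum (edge_difference E E') V (2 ^ m) i i)"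
    (is "_ \<le> measure_pmf.expectation G ?T")
proof -
  have fin: "finite (set_pmf G)"
    using assms(1,2) by (auto intro: finite_subset simp: finite_imp_finite_nsets)
  have int: "integrable (measure_pmf G) f" for f :: "'a set set \<Rightarrow> real"
    by (rule integrable_measure_pmf_finite[OF fin])
  have finI: "finite I" by (rule finite_subset[OF I(1) assms(1)])
  define Z where "Z = (\<lambda>E'. \<Sum>i\<in>I. \<Sum>j\<in>I. edge_difference E E' {i, j})"
  have "measure_pmf.expectation G (\<lambda>E'. edge_difference E E' {i, j}) = (if i = j then 0 else p)"
    if "i \<in> I" "j \<in> I" for i j
  proof (cases "i = j")
    case True
    have "{i} \<notin> E'" if "E' \<in> set_pmf G" for E'
      using subsetD[OF assms(2) that] singleton_notin_nsets_2[of _ V] by auto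
    then show ?thesis
      using True E by (auto intro!: integral_eq_zero_AE simp: AE_measure_pmf_iff edge_difference_def)
  next
    case False
    then have "{i, j} \<notin> E" using I that by (auto simp: indep_def)
    then have "(\<lambda>E'. edge_difference E E' {i, j}) = indicator {E'. {i, j} \<in> E'}"
      by (auto simp: edge_difference_def fun_eq_iff)
    then show ?thesis
      using prob[of "{i, j}"] False I that by auto
  qed
  then have "measure_pmf.expectation G Z = (\<Sum>i\<in>I. \<Sum>j\<in>I. if i = j then 0 else p)"
    unfolding Z_def by (simp add: Bochner_Integration.integral_sum int)
  also have "\<dots> = (\<Sum>i\<in>I. \<Sum>j\<in>I. p - (if i = j then p else 0))"
    by (intro sum.cong) auto
  also have "\<dots> = real (card I) * (p * (real (card I) - 1))"
    using finI by (simp add: sum_subtractf algebra_simps)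
  finally have EZ: "measure_pmf.expectation G Z = real (card I) * (p * (real (card I) - 1))" .
  \<comment> \<open>Evenness makes the power convex on the whole line, so Jensen applies without a
    sign condition.\<close>
  have "even (2 ^ m :: nat)" using assms(3) by simp
  then have "(measure_pmf.expectation G Z) ^ 2 ^ m \<le> measure_pmf.expectation G (\<lambda>E'. Z E' ^ 2 ^ m)"
    by (intro measure_pmf.jensens_inequality[where I = UNIV] int convex_power_even) auto
  also have "\<dots> \<le> measure_pmf.expectation G (\<lambda>E'. real (card I) ^ 2 ^ m * ?T E')"
    unfolding Z_def using assms
    by (intro integral_mono int quadratic_form_pow_le_trace)
  finally have "real (card I) ^ 2 ^ m * (p * (real (card I) - 1)) ^ 2 ^ m
      \<le> real (card I) ^ 2 ^ m * measure_pmf.expectation G ?T"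
    by (simp add: EZ power_mult_distrib)
  moreover have "real (card I) ^ 2 ^ m > 0"
    using I finI by (auto simp: card_gt_0_iff)
  ultimately show ?thesis
    by (simp only: mult_le_cancel_left_pos)
qed

text \<open>Markov's inequality for the conditional mean of the trace given \<open>E\<close>, which
  is nonnegative since the power is even. The factor 64 is \<open>32 * 2\<close>, from
  \<open>Q = 2 * p\<close>.\<close>

lemma prob_independent_set_le:
  fixes G :: "nat set set pmf"
  assumes G: "set_pmf G \<subseteq> Pow ([{1..N}]\<^bsup>2\<^esup>)"
    and indep: "\<And>F. F \<subseteq> [{1..N}]\<^bsup>2\<^esup> \<Longrightarrow> card F \<le> 2 * r \<Longrightarrow>
      prob_space.indep_vars (measure_pmf G) (\<lambda>_. borel) (\<lambda>e E. indicator E e :: real) F"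
    and prob: "\<And>e. e \<in> [{1..N}]\<^bsup>2\<^esup> \<Longrightarrow> measure_pmf.prob G {E. e \<in> E} = p"
    and p: "0 < p" "p \<le> 1" and r: "2 * r = 2 ^ m" "r > 0" "real r \<le> real N * (2 * p)" and s: "s \<ge> 2"
  shows "measure_pmf.prob G {E. has_independent_set N E s}
           \<le> 2 * real N * (64 * (exp 1)\<^sup>2 * real N / (p * (real s - 1)\<^sup>2)) ^ r"
proof -
  have m: "m > 0" using r(1) by (cases m) auto
  have fin: "finite (set_pmf G)"
    using G by (auto intro: finite_subset simp: finite_imp_finite_nsets)
  have int: "integrable (measure_pmf G) f" for f :: "nat set set \<Rightarrow> real"
    by (rule integrable_measure_pmf_finite[OF fin])
  let ?T = "\<lambda>E. measure_pmf.expectation G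
             (\<lambda>E'. \<Sum>i\<in>{1..N}. walk_sum (edge_difference E E') {1..N} (2 * r) i i)"
  let ?A = "{E. has_independent_set N E s}"
  define a where "a = (p * (real s - 1)) ^ (2 * r)"
  have a: "a > 0" using p s by (auto simp: a_def)
  have T_nonneg: "?T E \<ge> 0" for E
    by (intro Bochner_Integration.integral_nonneg) (simp add: trace_walk_sum_double sum_nonneg)
  have "a * measure_pmf.prob G ?A = measure_pmf.expectation G (\<lambda>E. a * indicator ?A E)"
    by simp
  also have "\<dots> \<le> measure_pmf.expectation G ?T"
  proof (intro integral_mono_AE int)
    show "AE E in measure_pmf G. a * indicator ?A E \<le> ?T E"
      unfolding AE_measure_pmf_iff
    proof
      fix E assume E: "E \<in> set_pmf G"
      show "a * indicator ?A E \<le> ?T E"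
      proof (cases "E \<in> ?A")
        case True
        then obtain I where I: "I \<subseteq> {1..N}" "card I = s" "indep I E"
          by (auto simp: has_independent_set_def)
        then have "I \<noteq> {}" using s by auto
        then have "a \<le> ?T E"
          using expectation_trace_lower_bound[OF _ G m prob E I(1,3)] I(2)
          by (simp add: a_def r(1))
        then show ?thesis using True by simp
      qed (use T_nonneg[of E] in simp)
    qed
  qed
  also have "\<dots> = (\<Sum>(i, xs)\<in>even_closed_walks {1..N} (2 * r). (2 * p * (1 - p)) ^ card (set (walk_edges i xs)))"
    by (intro expectation_trace_edge_difference G indep prob) auto
  also have "\<dots> \<le> 2 * real (card {1..N}) * (32 * (exp 1)\<^sup>2 * (real (card {1..N}) * (2 * p))) ^ r"
  proof (rule sum_even_closed_walks_bound)
    have "0 \<le> (1 - 2 * p)\<^sup>2" by simp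
    then show "2 * p * (1 - p) \<le> 1"
      unfolding power2_eq_square by (simp add: algebra_simps)
    show "2 * p * (1 - p) \<le> 2 * p"
      using p by (simp add: mult_le_cancel_left1)
  qed (use p r in auto)
  finally have "measure_pmf.prob G ?A \<le> 2 * real N * (64 * (exp 1)\<^sup>2 * real N * p) ^ r / a"
    using a by (simp add: field_simps)
  also have "\<dots> = 2 * real N * (64 * (exp 1)\<^sup>2 * real N * p / (p * (real s - 1))\<^sup>2) ^ r"
    by (simp add: a_def power_divide power_mult)
  also have "64 * (exp 1)\<^sup>2 * real N * p / (p * (real s - 1))\<^sup>2
      = 64 * (exp 1)\<^sup>2 * real N / (p * (real s - 1)\<^sup>2)"
    using p s by (simp add: power2_eq_square mult_ac)
  finally show ?thesis .
qed

subsection \<open>Independent sets\<close>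

text \<open>The estimates \<open>exp 1 \<le> 3\<close> and \<open>s - 1 \<ge> s / 2\<close> replace
  the constant by \<open>64 * 9 * 4 = 2304\<close>.\<close>

lemma k_wise_prob_independent_set_le:
  assumes G: "k_wise_independent_random_graph k p G"
    and r: "2 * r = 2 ^ m" "r > 0" "2 * r \<le> k N" "real r \<le> real N * (2 * p N)"
    and p: "0 < p N" and s: "s \<ge> 2"
  shows "measure_pmf.prob (G N) {E. has_independent_set N E s}
           \<le> 2 * real N * (2304 * real N / (p N * (real s)\<^sup>2)) ^ r"
proof -
  have "measure_pmf.prob (G N) {E. has_independent_set N E s}
      \<le> 2 * real N * (64 * (exp 1)\<^sup>2 * real N / (p N * (real s - 1)\<^sup>2)) ^ r"
    by (rule prob_independent_set_le[where m = m])
       (use assms in \<open>auto simp: k_wise_independent_random_graph_def\<close>)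
  also have "\<dots> \<le> 2 * real N * (2304 * real N / (p N * (real s)\<^sup>2)) ^ r"
  proof (intro mult_left_mono power_mono)
    have "(exp 1 :: real)\<^sup>2 \<le> 3\<^sup>2"
      by (intro power_mono exp_le) auto
    moreover have "(real s / 2)\<^sup>2 \<le> (real s - 1)\<^sup>2"
      using s by (intro power_mono) auto
    ultimately have "64 * (exp 1)\<^sup>2 * real N / (p N * (real s - 1)\<^sup>2)
        \<le> 64 * 3\<^sup>2 * real N / (p N * (real s / 2)\<^sup>2)"
      using p s by (intro frac_le mult_right_mono mult_left_mono) auto
    then show "64 * (exp 1)\<^sup>2 * real N / (p N * (real s - 1)\<^sup>2) \<le> 2304 * real N / (p N * (real s)\<^sup>2)"
      by (simp add: power_divide)
  qed (use p in auto)
  finally show ?thesis .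
qed

text \<open>Here \<open>r = 2\<close>. The fourth power of the normalization of \<open>S N\<close>
  is \<open>N ^ 3 / p ^ 2\<close>, so the bound on the probability is a constant over the fourth
  power of the normalized size.\<close>

lemma prob_independent_set_tendsto_0_4_wise:
  assumes G: "k_wise_independent_random_graph k p G"
    and S: "filterlim (\<lambda>N. real (S N) / (p N powr (-1/2) * real N powr (3/4))) at_top sequentially"
    and k: "\<forall>\<^sub>F N in sequentially. k N \<ge> 4"
    and p: "filterlim (\<lambda>N. p N * real N powr (1/2)) at_top sequentially"
  shows "(\<lambda>N. measure_pmf.prob (G N) {E. has_independent_set N E (S N)}) \<longlonglongrightarrow> 0"
proof -
  define X where "X = (\<lambda>N. real (S N) / (p N powr (-1/2) * real N powr (3/4)))"
  have "filterlim (\<lambda>N. X N ^ 4) at_top sequentially"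
    using S by (intro filterlim_pow_at_top) (auto simp: X_def)
  then have lim: "(\<lambda>N. 2 * 2304\<^sup>2 / X N ^ 4) \<longlonglongrightarrow> 0"
    by (rule real_tendsto_divide_at_top[OF tendsto_const])
  \<comment> \<open>The bound 2, together with a normalization of at least 1, yields
    \<open>S N \<ge> 2\<close>; the bound 1 yields \<open>p N * N \<ge> 1\<close>, the size
    condition for \<open>r = 2\<close>.\<close>
  have "\<forall>\<^sub>F N in sequentially. X N \<ge> 2" "\<forall>\<^sub>F N in sequentially. p N * real N powr (1/2) \<ge> 1"
    using S p by (simp_all add: X_def filterlim_at_top)
  then have "\<forall>\<^sub>F N in sequentially. measure_pmf.prob (G N) {E. has_independent_set N E (S N)}
      \<le> 2 * 2304\<^sup>2 / X N ^ 4"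
    using k eventually_ge_at_top[of 1]
  proof eventually_elim
    case (elim N)
    have p01: "0 \<le> p N" "p N \<le> 1"
      using G by (auto simp: k_wise_independent_random_graph_def)
    have p_pos: "p N > 0"
      using elim(2) p01(1) by (cases "p N = 0") auto
    define D where "D = p N powr (-1/2) * real N powr (3/4)"
    have "p N powr (-1/2) \<ge> 1 powr (-1/2)"
      using p_pos p01 by (intro powr_mono2') auto
    moreover have "real N powr (3/4) \<ge> 1"
      using elim by (intro ge_one_powr_ge_zero) auto
    ultimately have D: "D \<ge> 1"
      unfolding D_def using mult_mono[of 1 _ 1] by fastforce
    have "(p N powr (-1/2)) ^ 4 = p N powr (-2)"
      using p_pos by (subst powr_power) auto
    also have "\<dots> = 1 / (p N)\<^sup>2"
      using p_pos powr_minus_divide[of "p N" 2] by (simp add: powr_numeral)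
    finally have "D ^ 4 = 1 / (p N)\<^sup>2 * (real N powr (3/4)) ^ 4"
      by (simp only: D_def power_mult_distrib)
    also have "(real N powr (3/4)) ^ 4 = real N ^ 3"
      using elim by (subst powr_power) (auto simp: powr_numeral)
    finally have D4: "D ^ 4 = real N ^ 3 / (p N)\<^sup>2"
      by simp
    have "X N = real (S N) / D"
      by (simp only: X_def D_def)
    then have SX: "real (S N) = X N * D"
      using D by simp
    have "2 * 1 \<le> X N * D"
      using elim D by (intro mult_mono) auto
    then have s: "S N \<ge> 2"
      using SX by linarith
    have "real N powr (1/2) \<ge> 1"
      using elim by (intro ge_one_powr_ge_zero) auto
    then have "1 * 1 \<le> (p N * real N powr (1/2)) * real N powr (1/2)"
      using elim by (intro mult_mono) auto
    also have "\<dots> = p N * real N"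
      using elim powr_add[of "real N" "1/2" "1/2"] by (simp add: mult.assoc)
    finally have "real 2 \<le> real N * (2 * p N)" by (simp add: mult_ac)
    then have "measure_pmf.prob (G N) {E. has_independent_set N E (S N)}
        \<le> 2 * real N * (2304 * real N / (p N * (real (S N))\<^sup>2)) ^ 2"
      using elim p_pos s by (intro k_wise_prob_independent_set_le[OF G, of 2 2]) auto
    also have "\<dots> = 2 * 2304\<^sup>2 * (real N ^ 3 / (p N)\<^sup>2) / real (S N) ^ 4"
      by (simp add: power_divide power_mult_distrib power2_eq_square power3_eq_cube power4_eq_xxxx mult_ac)
    also have "\<dots> = 2 * 2304\<^sup>2 / X N ^ 4"
    proof -
      have "D ^ 4 \<noteq> 0" using D by simp
      then show ?thesis
        unfolding D4[symmetric] SX power_mult_distrib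
        by (rule nonzero_mult_divide_mult_cancel_right)
    qed
    finally show ?case .
  qed
  then show ?thesis
    by (rule tendsto_sandwich[OF always_eventually _ tendsto_const lim, rotated]) simp
qed

text \<open>The trace inequality needs \<open>2 * r\<close> to be a power of two, so the largest one
  not exceeding \<open>log 2 N\<close> is taken. This still gives
  \<open>r \<ge> log 2 N / 4\<close>, and a ratio of at most \<open>1 / 2 ^ 8\<close> then outweighs
  the factor \<open>2 * N\<close>.\<close>

lemma prob_independent_set_tendsto_0_log_wise:
  assumes G: "k_wise_independent_random_graph k p G"
    and S: "\<forall>\<^sub>F N in sequentially. real (S N) \<ge> 1000 * sqrt (real N / p N)"
    and k: "\<forall>\<^sub>F N in sequentially. real (k N) \<ge> log 2 (real N)"
    and p: "\<forall>\<^sub>F N in sequentially. p N \<ge> log 2 (real N) / real N"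
  shows "(\<lambda>N. measure_pmf.prob (G N) {E. has_independent_set N E (S N)}) \<longlonglongrightarrow> 0"
proof -
  have "\<forall>\<^sub>F N in sequentially. measure_pmf.prob (G N) {E. has_independent_set N E (S N)} \<le> 2 / real N"
    using S k p eventually_ge_at_top[of 4]
  proof eventually_elim
    case (elim N)
    define x where "x = log 2 (real N)"
    have N: "real N \<ge> 4" using elim by simp
    have "log 2 (2 ^ 2) \<le> x"
      unfolding x_def using N by (subst log_le_cancel_iff) auto
    then have x: "x \<ge> 2"
      using log_pow_cancel[of "2::real" 2] by simp
    obtain m where m: "2 ^ m \<le> nat \<lfloor>x\<rfloor>" "nat \<lfloor>x\<rfloor> < 2 ^ (m + 1)"
      using ex_power_ivl1[of 2 "nat \<lfloor>x\<rfloor>"] x by (auto simp: le_nat_iff le_floor_iff)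
    \<comment> \<open>\<open>2 ^ m\<close> has to be even in order to be \<open>2 * r\<close>; this
      is where \<open>N \<ge> 4\<close> is needed.\<close>
    have "m \<noteq> 0"
    proof
      assume "m = 0"
      then have "nat \<lfloor>x\<rfloor> < 2" using m by simp
      then show False using x by linarith
    qed
    then obtain n where n: "m = Suc n" by (cases m) auto
    define r where "r = (2::nat) ^ n"
    have r: "2 * r = 2 ^ m" "r > 0" by (auto simp: r_def n)
    have r_le: "real (2 * r) \<le> x"
      using m(1) r(1) x by linarith
    have "nat \<lfloor>x\<rfloor> + 1 \<le> 4 * r"
      using m(2) by (simp add: r_def n)
    then have x_le: "x \<le> 4 * real r" by linarith
    have p1: "p N \<le> 1"
      using G by (auto simp: k_wise_independent_random_graph_def)
    \<comment> \<open>The density condition gives \<open>N * p N \<ge> log 2 N \<ge> 2 * r\<close>,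
      from which the size condition on \<open>r\<close> follows.\<close>
    have xp: "x \<le> p N * real N"
      using elim N by (simp add: x_def divide_le_eq)
    then have p_pos: "p N > 0"
      using x N by (smt (verit) mult_nonpos_nonneg)
    have "1 \<le> real N / p N"
      using p_pos p1 N by (simp add: le_divide_eq)
    then have "1 \<le> sqrt (real N / p N)"
      by simp
    then have s: "S N \<ge> 2"
      using elim(1) by linarith
    have "(1000 * sqrt (real N / p N))\<^sup>2 \<le> (real (S N))\<^sup>2"
      using elim p_pos by (intro power_mono) auto
    then have "1000000 * (real N / p N) \<le> (real (S N))\<^sup>2"
      using p_pos by (simp add: power_mult_distrib)
    \<comment> \<open>The constant 1000 is large enough because \<open>1000 ^ 2\<close> exceeds
      \<open>2304 * 2 ^ 8 = 589824\<close>.\<close>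
    then have ratio: "2304 * real N / (p N * (real (S N))\<^sup>2) \<le> 1 / 2 ^ 8"
      using p_pos s N by (simp add: field_simps)
    have "2 * r \<le> k N"
      using r_le elim(2) by (simp add: x_def)
    moreover have "real r \<le> real N * (2 * p N)"
      using r_le xp x by (simp add: mult_ac)
    ultimately have "measure_pmf.prob (G N) {E. has_independent_set N E (S N)}
        \<le> 2 * real N * (2304 * real N / (p N * (real (S N))\<^sup>2)) ^ r"
      by (intro k_wise_prob_independent_set_le[OF G r] p_pos s)
    also have "\<dots> \<le> 2 * real N * (1 / 2 ^ 8) ^ r"
      using ratio p_pos by (intro mult_left_mono power_mono) auto
    also have "\<dots> = 2 * real N / (2 ^ (4 * r))\<^sup>2"
    proof -
      have "((2::real) ^ (4 * r))\<^sup>2 = (2 ^ 8) ^ r"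
        unfolding power_mult[symmetric] by simp
      then show ?thesis by (simp add: power_divide)
    qed
    also have "\<dots> \<le> 2 * real N / (real N)\<^sup>2"
    proof (intro divide_left_mono power_mono)
      have "real N = 2 powr x"
        using N by (simp add: x_def)
      also have "\<dots> \<le> 2 powr real (4 * r)"
        using x_le by (intro powr_mono) auto
      also have "\<dots> = 2 ^ (4 * r)"
        by (rule powr_realpow) simp
      finally show "real N \<le> 2 ^ (4 * r)" .
    qed (use N in auto)
    also have "\<dots> = 2 / real N"
      using N by (simp add: power2_eq_square)
    finally show ?case .
  qed
  moreover have "(\<lambda>N. 2 / real N) \<longlonglongrightarrow> 0"
    by (rule lim_const_over_n)
  ultimately show ?thesis
    by (rule tendsto_sandwich[OF always_eventually _ tendsto_const, rotated]) simp
qed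

theorem mainTheorem12:
  shows "\<exists>c1 c2 :: real. c1 > 0 \<and> c2 > 0 \<and>
    (\<forall>(k :: nat \<Rightarrow> nat) (p :: nat \<Rightarrow> real) (G :: nat \<Rightarrow> nat set set pmf) (S :: nat \<Rightarrow> nat).
      k_wise_independent_random_graph k p G \<longrightarrow>
      ((filterlim (\<lambda>N. real (S N) / (p N powr (-1/2) * real N powr (3/4))) at_top sequentially \<and>
        (\<forall>\<^sub>F N in sequentially. k N \<ge> 4) \<and>
        filterlim (\<lambda>N. p N * real N powr (1/2)) at_top sequentially)
       \<or>
       ((\<forall>\<^sub>F N in sequentially. real (S N) \<ge> c1 * sqrt (real N / p N)) \<and>
        (\<forall>\<^sub>F N in sequentially. real (k N) \<ge> log 2 (real N)) \<and>
        (\<forall>\<^sub>F N in sequentially. p N \<ge> c2 * log 2 (real N) / real N))) \<longrightarrow>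
      (\<lambda>N. measure_pmf.prob (G N) {E. \<not> has_independent_set N E (S N)}) \<longlonglongrightarrow> 1)"
proof -
  have compl: "(\<lambda>N. measure_pmf.prob (G N) {E. \<not> has_independent_set N E (S N)}) \<longlonglongrightarrow> 1"
    if "(\<lambda>N. measure_pmf.prob (G N) {E. has_independent_set N E (S N)}) \<longlonglongrightarrow> 0"
    for G :: "nat \<Rightarrow> nat set set pmf" and S :: "nat \<Rightarrow> nat"
  proof -
    have "measure_pmf.prob (G N) {E. \<not> has_independent_set N E (S N)}
        = 1 - measure_pmf.prob (G N) {E. has_independent_set N E (S N)}" for N
      using measure_pmf.prob_compl[of "{E. has_independent_set N E (S N)}" "G N"]
      by (simp add: Collect_neg_eq Compl_eq_Diff_UNIV)
    then show ?thesis
      using tendsto_diff[OF tendsto_const[of 1] that] by simp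
  qed
  \<comment> \<open>The witnesses \<open>c1 = 1000\<close> and \<open>c2 = 1\<close> come from the
    logarithmic regime; the 4-wise regime involves neither.\<close>
  show ?thesis
  proof (rule exI[of _ 1000], rule exI[of _ 1], intro conjI allI impI)
    fix k p G S
    assume G: "k_wise_independent_random_graph k p G"
      and "(filterlim (\<lambda>N. real (S N) / (p N powr (-1/2) * real N powr (3/4))) at_top sequentially \<and>
        (\<forall>\<^sub>F N in sequentially. k N \<ge> 4) \<and>
        filterlim (\<lambda>N. p N * real N powr (1/2)) at_top sequentially)
       \<or>
       ((\<forall>\<^sub>F N in sequentially. real (S N) \<ge> 1000 * sqrt (real N / p N)) \<and>
        (\<forall>\<^sub>F N in sequentially. real (k N) \<ge> log 2 (real N)) \<and>
        (\<forall>\<^sub>F N in sequentially. p N \<ge> 1 * log 2 (real N) / real N))"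
    then show "(\<lambda>N. measure_pmf.prob (G N) {E. \<not> has_independent_set N E (S N)}) \<longlonglongrightarrow> 1"
      using prob_independent_set_tendsto_0_4_wise[OF G] prob_independent_set_tendsto_0_log_wise[OF G]
      by (intro compl) auto
  qed auto
qed

end
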